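(* Let $n\ge1$ and let $m$ be a positive integer. Let $\eta,\lambda$ be vectors, either both of integers or both of half-integers, in $\mathcal A^{\tilde A_{n-1}}_m=\{(x_1,\dots,x_n)\in\mathbb R^n: x_1>x_2>\dots>x_n>x_1-m\}$. Then, as $k\to\infty$ with $k\equiv 2\eta_j+2\lambda_j\pmod 2$, the number of walks from $\eta$ to $\lambda$ with exactly $k$ diagonal steps staying in $\mathcal A^{\tilde A_{n-1}}_m$ is asymptotically $$\frac{1}{m^{n-1}}\frac{2^{n^2-n}}{\sqrt{2\pi c_0k}}\left(2^n\prod_{j=1}^n\cos\frac{\pi(j-\frac{n+1}2)}{m}\right)^k\prod_{1\le h<t\le n}\left(\sin\frac{\pi(\eta_h-\eta_t)}{m}\cdot\sin\frac{\pi(\lambda_h-\lambda_t)}{m}\right),$$ where $c_0=\sum_{j=1}^n\left(2\cos\frac{\pi(j-\frac{n+1}2)}{m}\right)^{-2}$.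
   Context: A half-integer is an odd integer divided by $2$. A walk with $k$ steps from $\eta$ to $\lambda$ is a sequence $p_0=\eta,\dots,p_k=\lambda$ with $p_i-p_{i-1}\in S$; "diagonal steps" means $S=\{(\pm\frac12,\pm\frac12,\dots,\pm\frac12)\}$ (all $2^n$ sign patterns). The walk stays in $R$ if all $p_i\in R$. "Asymptotically $E$" means the ratio of the count to $E$ tends to $1$. *)

theory Defs
  imports "HOL-Analysis.Analysis" "HOL-Library.Real_Mod"
begin

text \<open>
  Points of \<open>\<real>\<^sup>n\<close> are functions \<open>x :: nat \<Rightarrow> real\<close> whose coordinates are
  \<open>x 1, \<dots>, x n\<close> and which vanish at all other indices. With this padding, equality and
  (pointwise) subtraction of points are those of the function type.
\<close>

definition Rspace :: "nat \<Rightarrow> (nat \<Rightarrow> real) set" where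
  "Rspace n = {x. \<forall>j. j \<notin> {1..n} \<longrightarrow> x j = 0}"

definition half_integers :: "real set" where
  "half_integers = {of_int z / 2 | z :: int. odd z}"

definition diagonal_steps :: "nat \<Rightarrow> (nat \<Rightarrow> real) set" where
  "diagonal_steps n = {s \<in> Rspace n. \<forall>j\<in>{1..n}. s j = 1/2 \<or> s j = - (1/2)}"

definition alcove :: "nat \<Rightarrow> real \<Rightarrow> (nat \<Rightarrow> real) set" where
  "alcove n m = {x \<in> Rspace n. (\<forall>j\<in>{1..<n}. x j > x (j + 1)) \<and> x n > x 1 - m}"

text \<open>A walk with \<open>k\<close> steps is the list of its \<open>k + 1\<close> points.\<close>

definition walks :: "'a :: minus set \<Rightarrow> 'a set \<Rightarrow> 'a \<Rightarrow> 'a \<Rightarrow> nat \<Rightarrow> 'a list set" where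
  "walks S R a b k =
     {p. length p = k + 1 \<and> p ! 0 = a \<and> p ! k = b \<and>
         (\<forall>i\<in>{1..k}. p ! i - p ! (i - 1) \<in> S) \<and> (\<forall>i\<in>{0..k}. p ! i \<in> R)}"

end

theory Submission
  imports
    Defs
    "Jordan_Normal_Form.Determinant"
    "HOL-Probability.Distributions"
    "HOL-Real_Asymp.Real_Asymp"
begin

text \<open>
  Walks in the alcove are non-colliding particles on a circle of length \<open>m\<close>, so the transfer
  operator is diagonalised by determinants of plane waves \<open>det (cis (- \<theta> (a j) * x l))\<close> whose
  momenta lie in a coset of \<open>2\<pi>\<int>/m\<close>: a diagonal step multiplies such a determinant by
  \<open>\<Prod>j. 2 cos (\<theta> (a j) / 2)\<close>, and it vanishes on all walls. Since the walk is not confined in the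
  direction \<open>(1,\<dots>,1)\<close>, the coset is a free parameter \<open>\<psi>\<close>, and the number of walks is the integral
  over one period of \<open>\<psi>\<close> of the sum over all \<open>a\<close>. The modulus of the eigenvalue is maximal exactly for the \<open>n\<close>
  consecutive momenta centred at \<open>0\<close>, that is, at \<open>\<psi> = 0\<close> and for \<open>a\<close> a permutation
  of \<open>{0..<n}\<close>. Laplace's method at this point gives the Gaussian factor, and Vandermonde's
  determinant turns the two eigenfunctions into the products of sines.
\<close>

section \<open>Walks with diagonal steps\<close>

text \<open>For a fixed \<open>\<psi>\<close> the sum over momenta does not separate all points of
  the alcove: besides a point it also detects (x_2, ..., x_n, x_1 - m) and the iterates of this
  rotation, which are the same configuration on the circle. Their coordinate sums differ by nonzero
  multiples of m, and the phase in \<open>\<psi>\<close> records exactly this sum, so integrating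
  over a period removes them. The same parameter shapes the estimates. At \<open>\<psi>\<close> =
  1/2 and -1/2 another set of momenta ties with the central one whenever n < m, so there is no
  uniform spectral gap. After the substitution \<open>\<psi> = t / sqrt k\<close>, dominated
  convergence gets by with less: a strict inequality at \<open>\<psi> = 0\<close> alone, which
  yields the pointwise limits, and a Gaussian bound for the central eigenvalue on the whole period,
  which dominates the other eigenvalues as well. The Jacobian of the substitution is the source of
  the square root of k. The indices b < m cover one period of |cos|, so no second maximum
  occurs.\<close>

lemma walks_0: "walks S R a b 0 = (if a = b \<and> a \<in> R then {[a]} else {})"
  by (auto simp: walks_def length_Suc_conv)

lemma walks_eq_empty:
  assumes "b \<notin> R"
  shows "walks S R a b k = {}"
proof -
  have "b \<in> R" if "p \<in> walks S R a b k" for p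
  proof -
    have "p ! k = b" "\<forall>i\<in>{0..k}. p ! i \<in> R" using that by (simp_all add: walks_def)
    then show ?thesis by force
  qed
  then show ?thesis using assms by blast
qed

text \<open>The last step is split off, not the first: the start stays fixed and the recursion runs
  over the end point, the variable of the determinants below.\<close>

lemma walks_Suc:
  fixes a b :: "'i \<Rightarrow> 'a::ab_group_add"
  assumes "b \<in> R"
  shows "walks S R a b (Suc k) = (\<Union>s\<in>S. (\<lambda>p. p @ [b]) ` walks S R a (b - s) k)"
proof (intro subset_antisym subsetI)
  fix p assume p: "p \<in> walks S R a b (Suc k)"
  define q where "q = butlast p"
  have len: "length q = Suc k" using p by (simp add: walks_def q_def)
  have "p \<noteq> []" using p by (auto simp: walks_def)
  moreover from this have "last p = b" using p by (simp add: walks_def last_conv_nth)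
  ultimately have pq: "p = q @ [b]" unfolding q_def using append_butlast_last_id by metis
  have nth: "p ! i = q ! i" if "i \<le> k" for i
    using that len by (simp add: pq nth_append)
  have "p ! Suc k = b" using p by (simp add: walks_def)
  have step: "b - q ! k \<in> S"
    using p nth[of k] by (auto simp: walks_def dest: bspec[of _ _ "Suc k"])
  have "q ! i - q ! (i - 1) \<in> S" if "i \<in> {1..k}" for i
    using p that nth[of i] nth[of "i - 1"] by (auto simp: walks_def dest: bspec[of _ _ i])
  moreover have "q ! i \<in> R" if "i \<in> {0..k}" for i
    using p that nth[of i] by (auto simp: walks_def dest: bspec[of _ _ i])
  moreover have "b - (b - q ! k) = q ! k" by (simp add: fun_eq_iff)
  ultimately have "q \<in> walks S R a (b - (b - q ! k)) k"
    using p nth[of 0] len by (simp add: walks_def)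
  then show "p \<in> (\<Union>s\<in>S. (\<lambda>p. p @ [b]) ` walks S R a (b - s) k)"
    using step pq by auto
next
  fix p assume "p \<in> (\<Union>s\<in>S. (\<lambda>p. p @ [b]) ` walks S R a (b - s) k)"
  then obtain s q where s: "s \<in> S" and q: "q \<in> walks S R a (b - s) k" and p: "p = q @ [b]"
    by auto
  have len: "length q = Suc k" and qk: "q ! k = b - s" using q by (auto simp: walks_def)
  have "b - (b - s) = s" by (simp add: fun_eq_iff)
  then show "p \<in> walks S R a b (Suc k)"
    using q s qk len assms
    by (auto simp: walks_def p nth_append le_Suc_eq)
qed

lemma finite_walks:
  fixes a b :: "'i \<Rightarrow> 'a::ab_group_add"
  assumes "finite S"
  shows "finite (walks S R a b k)"
proof (induction k arbitrary: b)
  case (Suc k)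
  show ?case
  proof (cases "b \<in> R")
    case False
    then show ?thesis by (simp add: walks_eq_empty)
  qed (use Suc assms in \<open>simp add: walks_Suc\<close>)
qed (simp add: walks_0)

lemma card_walks_Suc:
  fixes a b :: "'i \<Rightarrow> 'a::ab_group_add"
  assumes "finite S" "b \<in> R"
  shows "card (walks S R a b (Suc k)) = (\<Sum>s\<in>S. card (walks S R a (b - s) k))"
proof -
  have disj: "s = t" if "p \<in> walks S R a (b - s) k" "p \<in> walks S R a (b - t) k" for p s t
  proof -
    from that have "b - s = b - t" by (simp add: walks_def)
    then show ?thesis by (simp add: fun_eq_iff)
  qed
  have "card (walks S R a b (Suc k)) = (\<Sum>s\<in>S. card ((\<lambda>p. p @ [b]) ` walks S R a (b - s) k))"
    unfolding walks_Suc[OF assms(2)]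
    by (rule card_UN_disjoint) (use assms disj in \<open>auto simp: finite_walks\<close>)
  also have "\<dots> = (\<Sum>s\<in>S. card (walks S R a (b - s) k))"
    by (intro sum.cong refl card_image inj_onI) simp
  finally show ?thesis .
qed

lemma diagonal_steps_bij:
  "bij_betw (\<lambda>g j. if j \<in> {1..n} then g j else 0)
     (PiE {1..n} (\<lambda>_. {1/2, -(1/2)})) (diagonal_steps n)"
proof (rule bij_betwI[where g = "\<lambda>s. restrict s {1..n}"])
  show "restrict (\<lambda>j. if j \<in> {1..n} then g j else 0) {1..n} = g"
    if "g \<in> PiE {1..n} (\<lambda>_. {1/2, -(1/2)})" for g :: "nat \<Rightarrow> real"
    using that by (auto simp: fun_eq_iff PiE_def extensional_def)
qed (auto simp: diagonal_steps_def Rspace_def fun_eq_iff)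

lemma finite_diagonal_steps: "finite (diagonal_steps n)"
  using bij_betw_finite[OF diagonal_steps_bij[of n]] by (simp add: finite_PiE)

text \<open>The coordinates of a diagonal step are chosen independently, so a product of
  one-coordinate functions sums to a product of two-term sums. Factors are indexed from 0,
  coordinates from 1.\<close>

lemma sum_prod_diagonal_steps:
  fixes h :: "nat \<Rightarrow> real \<Rightarrow> 'a :: comm_semiring_1"
  shows "(\<Sum>s\<in>diagonal_steps n. \<Prod>l=0..<n. h l (s (Suc l))) =
    (\<Prod>l=0..<n. h l (1/2) + h l (-(1/2)))"
proof -
  have "(\<Prod>l=0..<n. h l (1/2) + h l (-(1/2))) = (\<Prod>l\<in>{1..n}. \<Sum>y\<in>{1/2, -(1/2)}. h (l - 1) y)"
    by (rule prod.reindex_bij_witness[of _ "\<lambda>l. l - 1" Suc]) auto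
  also have "\<dots> = (\<Sum>g\<in>PiE {1..n} (\<lambda>_. {1/2, -(1/2)}). \<Prod>l\<in>{1..n}. h (l - 1) (g l))"
    by (rule prod_sum_PiE) auto
  also have "\<dots> = (\<Sum>g\<in>PiE {1..n} (\<lambda>_. {1/2, -(1/2)}).
      \<Prod>l\<in>{1..n}. h (l - 1) (if l \<in> {1..n} then g l else 0))"
    by (intro sum.cong prod.cong) auto
  also have "\<dots> = (\<Sum>s\<in>diagonal_steps n. \<Prod>l\<in>{1..n}. h (l - 1) (s l))"
    by (rule sum.reindex_bij_betw[OF diagonal_steps_bij])
  also have "\<dots> = (\<Sum>s\<in>diagonal_steps n. \<Prod>l=0..<n. h l (s (Suc l)))"
    by (intro sum.cong refl prod.reindex_bij_witness[of _ Suc "\<lambda>l. l - 1"]) auto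
  finally show ?thesis ..
qed

text \<open>The coordinates change by \<open>\<plusminus> 1/2\<close> and differ by integers, so a step leaving the alcove ends
  on a wall; a solution of the recursion vanishing on the walls therefore counts walks.\<close>
lemma of_nat_card_walks_eqI:
  fixes W :: "nat \<Rightarrow> (nat \<Rightarrow> real) \<Rightarrow> 'a::semiring_1"
  assumes rec: "\<And>k x. W (Suc k) x = (\<Sum>s\<in>diagonal_steps n. W k (x - s))"
    and wall: "\<And>k x l. l \<in> {1..<n} \<Longrightarrow> x l = x (l + 1) \<Longrightarrow> W k x = 0"
    and affine_wall: "\<And>k x. x n = x 1 - real m \<Longrightarrow> W k x = 0"
    and init: "\<And>x. x \<in> alcove n (real m) \<Longrightarrow> \<forall>l\<in>{1..n}. x l - \<eta> l \<in> \<int> \<Longrightarrow>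
                 W 0 x = (if x = \<eta> then 1 else 0)"
    and \<eta>: "\<eta> \<in> alcove n (real m)" "\<forall>l\<in>{1..n}. \<forall>l'\<in>{1..n}. \<eta> l - \<eta> l' \<in> \<int>"
    and n: "n \<ge> 1"
  shows "x \<in> alcove n (real m) \<Longrightarrow> \<forall>l\<in>{1..n}. x l - \<eta> l - real k / 2 \<in> \<int> \<Longrightarrow>
    of_nat (card (walks (diagonal_steps n) (alcove n (real m)) \<eta> x k)) = W k x"
proof (induction k arbitrary: x)
  case 0
  then show ?case using init[of x] \<eta>(1) by (auto simp: walks_0)
next
  case (Suc k)
  have diff: "x l - x l' \<in> \<int>" if "l \<in> {1..n}" "l' \<in> {1..n}" for l l'
  proof -
    have "(x l - \<eta> l - real (Suc k) / 2) - (x l' - \<eta> l' - real (Suc k) / 2) + (\<eta> l - \<eta> l') \<in> \<int>"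
      by (rule Ints_add[OF Ints_diff]) (use Suc.prems(2) \<eta>(2) that in blast)+
    then show ?thesis by simp
  qed
  have ge1: "y \<ge> 1" if "y \<in> \<int>" "y > 0" for y :: real
    using that by (auto elim!: Ints_cases)
  have step: "of_nat (card (walks (diagonal_steps n) (alcove n (real m)) \<eta> (x - s) k)) = W k (x - s)"
    if s: "s \<in> diagonal_steps n" for s
  proof (cases "x - s \<in> alcove n (real m)")
    case True
    have "(x - s) l - \<eta> l - real k / 2 \<in> \<int>" if "l \<in> {1..n}" for l
    proof -
      have "(x - s) l - \<eta> l - real k / 2 = (x l - \<eta> l - real (Suc k) / 2) + (1 / 2 - s l)"
        by (simp add: field_simps)
      also have "\<dots> \<in> \<int>"
      proof (rule Ints_add)
        have "s l = 1/2 \<or> s l = - (1/2)" using s that by (simp add: diagonal_steps_def)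
        then show "1 / 2 - s l \<in> \<int>" by (elim disjE) (simp_all only:, simp_all)
      qed (use Suc.prems(2) that in auto)
      finally show ?thesis .
    qed
    then show ?thesis using True by (intro Suc.IH ballI)
  next
    case False
    have R: "x - s \<in> Rspace n"
      using s Suc.prems(1) by (auto simp: diagonal_steps_def Rspace_def alcove_def)
    have sb: "\<bar>s l\<bar> = 1/2" if "l \<in> {1..n}" for l
      using s that by (force simp: diagonal_steps_def)
    have W0: "W k (x - s) = 0"
    proof (cases "\<forall>j\<in>{1..<n}. (x - s) j > (x - s) (j + 1)")
      case True
      with R False have le: "(x - s) n \<le> (x - s) 1 - real m" by (auto simp: alcove_def)
      have "x n - x 1 + real m \<ge> 1"
        using diff[of n 1] n Suc.prems(1) by (intro ge1) (auto simp: alcove_def)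
      then have "(x - s) n = (x - s) 1 - real m"
        using le sb[of 1] sb[of n] n by simp
      then show ?thesis by (rule affine_wall)
    next
      case False
      then obtain j where j: "j \<in> {1..<n}" and le: "(x - s) j \<le> (x - s) (j + 1)" by force
      have "x j - x (j + 1) \<ge> 1"
        using diff[of j "j + 1"] j Suc.prems(1) by (intro ge1) (auto simp: alcove_def)
      then have "(x - s) j = (x - s) (j + 1)"
        using le sb[of j] sb[of "j + 1"] j by simp
      with j show ?thesis by (rule wall)
    qed
    with False show ?thesis by (simp add: walks_eq_empty)
  qed
  show ?case
    by (simp add: card_walks_Suc[OF finite_diagonal_steps Suc.prems(1)] rec step)
qed

section \<open>Vandermonde determinants of plane waves\<close>

text \<open>Column operations pass from monomials to the Newton basis \<open>P\<close>: the change
  of basis \<open>C\<close> is upper unitriangular, and \<open>V * C\<close> is lower triangular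
  because \<open>P j\<close> vanishes at \<open>z l\<close> for l < j.\<close>

lemma det_Vandermonde:
  fixes z :: "nat \<Rightarrow> 'a :: idom"
  shows "Determinant.det (Matrix.mat n n (\<lambda>(l, j). z l ^ j)) = (\<Prod>t<n. \<Prod>h<t. z t - z h)"
proof -
  define P where "P j = (\<Prod>i<j. [:- z i, 1:])" for j
  have deg: "degree (P j) = j" for j
    by (simp add: P_def degree_prod_eq_sum_degree)
  have lead: "coeff (P j) j = 1" for j
    using lead_coeff_prod[of "\<lambda>i. [:- z i, 1:]" "{..<j}"] deg[of j] by (simp add: P_def)
  define V where "V = Matrix.mat n n (\<lambda>(l, j). z l ^ j)"
  define C where "C = Matrix.mat n n (\<lambda>(i, j). coeff (P j) i)"
  have VC: "V * C = Matrix.mat n n (\<lambda>(l, j). poly (P j) (z l))"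
  proof (rule eq_matI)
    fix l j assume "l < dim_row (Matrix.mat n n (\<lambda>(l, j). poly (P j) (z l)))"
      "j < dim_col (Matrix.mat n n (\<lambda>(l, j). poly (P j) (z l)))"
    then have lj: "l < n" "j < n" by auto
    have "poly (P j) (z l) = (\<Sum>i\<le>j. coeff (P j) i * z l ^ i)"
      using deg[of j] by (simp add: poly_altdef)
    also have "\<dots> = (\<Sum>i=0..<n. coeff (P j) i * z l ^ i)"
      by (rule sum.mono_neutral_left) (use lj deg in \<open>auto intro: coeff_eq_0\<close>)
    finally show "(V * C) $$ (l, j) = Matrix.mat n n (\<lambda>(l, j). poly (P j) (z l)) $$ (l, j)"
      using lj by (simp add: V_def C_def scalar_prod_def mult.commute)
  qed (auto simp: V_def C_def)
  have "Determinant.det C = (\<Prod>i=0..<n. C $$ (i, i))"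
    by (subst det_upper_triangular[of _ n])
       (auto simp: C_def prod_list_diag_prod intro!: upper_triangularI coeff_eq_0 simp: deg)
  also have "\<dots> = 1" by (simp add: C_def lead)
  finally have "Determinant.det V = Determinant.det (V * C)"
    by (subst det_mult[of _ n]) (auto simp: V_def C_def)
  also have "\<dots> = (\<Prod>i=0..<n. (V * C) $$ (i, i))"
    unfolding VC
    by (subst det_lower_triangular[of n]) (auto simp: prod_list_diag_prod P_def poly_prod)
  also have "\<dots> = (\<Prod>t<n. \<Prod>h<t. z t - z h)"
    unfolding VC by (auto simp: P_def poly_prod atLeast0LessThan intro!: prod.cong)
  finally show ?thesis unfolding V_def .
qed

text \<open>At the affine wall two rows of the plane-wave matrix agree only up to a phase, hence the
  factor \<open>c\<close>.\<close>

lemma det_proportional_rows: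
  fixes f :: "nat \<Rightarrow> nat \<Rightarrow> 'a :: comm_ring_1"
  assumes "l < n" "l' < n" "l \<noteq> l'" "\<And>j. j < n \<Longrightarrow> f l' j = c * f l j"
  shows "Determinant.det (Matrix.mat n n (\<lambda>(i, j). f i j)) = 0"
proof -
  define A where "A = Matrix.mat n n (\<lambda>(i, j). if i = l' then f l j else f i j)"
  have "Determinant.det A = 0"
    by (rule det_identical_rows[of _ n l l']) (use assms in \<open>auto simp: A_def\<close>)
  moreover have "Matrix.mat n n (\<lambda>(i, j). f i j) = multrow l' c A"
    by (rule eq_matI) (use assms in \<open>auto simp: A_def\<close>)
  ultimately show ?thesis using assms by (simp add: det_multrow[of _ n] A_def)
qed

lemma det_scale_rows:
  fixes f :: "nat \<Rightarrow> nat \<Rightarrow> 'a :: comm_ring_1"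
  shows "Determinant.det (Matrix.mat n n (\<lambda>(l, j). c l * f l j)) =
    (\<Prod>l<n. c l) * Determinant.det (Matrix.mat n n (\<lambda>(l, j). f l j))"
proof -
  have "(\<Prod>l=0..<n. Matrix.mat n n (\<lambda>(l, j). c l * f l j) $$ (l, p l)) =
      (\<Prod>l<n. c l) * (\<Prod>l=0..<n. Matrix.mat n n (\<lambda>(l, j). f l j) $$ (l, p l))"
    if "p permutes {0..<n}" for p
    unfolding lessThan_atLeast0 prod.distrib[symmetric]
    by (intro prod.cong refl) (use permutes_in_image[OF that] in auto)
  then show ?thesis
    unfolding det_def'[OF mat_carrier] sum_distrib_left
    by (intro sum.cong refl) (simp add: mult_ac)
qed

lemma complex_diff_cis:
  "cis b - cis a = 2 * \<i> * cis ((a + b) / 2) * complex_of_real (sin ((b - a) / 2))"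
proof -
  have "cis ((a + b) / 2 + (b - a) / 2) - cis ((a + b) / 2 - (b - a) / 2) =
      2 * \<i> * cis ((a + b) / 2) * complex_of_real (sin ((b - a) / 2))"
    by (simp add: complex_eq_iff cos_add sin_add cos_diff sin_diff)
  moreover have "(a + b) / 2 + (b - a) / 2 = b" "(a + b) / 2 - (b - a) / 2 = a"
    by (simp_all add: field_simps)
  ultimately show ?thesis by simp
qed

text \<open>Each index lies in exactly \<open>n - 1\<close> of the pairs.\<close>

lemma prod_pairs_mult:
  fixes w :: "nat \<Rightarrow> 'a :: comm_monoid_mult"
  shows "(\<Prod>t<n. \<Prod>h<t. w h * w t) = (\<Prod>l<n. w l ^ (n - 1))"
proof (induction n)
  case (Suc n)
  have "(\<Prod>t<Suc n. \<Prod>h<t. w h * w t) = (\<Prod>l<n. w l ^ (n - 1)) * (\<Prod>h<n. w h) * w n ^ n"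
    unfolding Suc[symmetric] by (simp add: prod.distrib mult_ac)
  also have "(\<Prod>l<n. w l ^ (n - 1)) * (\<Prod>h<n. w h) = (\<Prod>l<n. w l ^ n)"
    unfolding prod.distrib[symmetric] by (intro prod.cong refl power_minus_mult) auto
  finally show ?case by simp
qed simp

text \<open>Centring the exponents extracts \<open>w l ^ (n - 1)\<close> from row l. Distributed as
  \<open>w h * w t\<close> over the pairs, these factors cancel the phase in the half-angle form of
  each Vandermonde factor, so that only sines are left.\<close>

lemma det_cis_centred:
  fixes y :: "nat \<Rightarrow> real"
  shows "Determinant.det (Matrix.mat n n (\<lambda>(l, j). cis ((real j - (real n - 1) / 2) * y l))) =
    (\<Prod>t<n. \<Prod>h<t. 2 * \<i> * complex_of_real (sin ((y t - y h) / 2)))"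
proof -
  define w where "w l = cis (- (y l / 2))" for l
  have "cis ((real j - (real n - 1) / 2) * y l) = w l ^ (n - 1) * cis (y l) ^ j" if "n \<ge> 1" for l j
    using that by (simp add: w_def Complex.DeMoivre cis_mult of_nat_diff field_simps)
  then have "Determinant.det (Matrix.mat n n (\<lambda>(l, j). cis ((real j - (real n - 1) / 2) * y l))) =
     Determinant.det (Matrix.mat n n (\<lambda>(l, j). w l ^ (n - 1) * cis (y l) ^ j))"
    by (intro arg_cong[where f = Determinant.det] eq_matI) auto
  also have "\<dots> = (\<Prod>l<n. w l ^ (n - 1)) * Determinant.det (Matrix.mat n n (\<lambda>(l, j). cis (y l) ^ j))"
    by (rule det_scale_rows)
  also have "\<dots> = (\<Prod>t<n. \<Prod>h<t. w h * w t * (cis (y t) - cis (y h)))"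
    unfolding det_Vandermonde prod_pairs_mult[symmetric] by (simp only: prod.distrib)
  also have "\<dots> = (\<Prod>t<n. \<Prod>h<t. 2 * \<i> * complex_of_real (sin ((y t - y h) / 2)))"
  proof (intro prod.cong refl)
    fix t h
    have "w h * w t * cis ((y h + y t) / 2) = 1"
      by (simp add: w_def cis_mult field_simps)
    then show "w h * w t * (cis (y t) - cis (y h)) = 2 * \<i> * complex_of_real (sin ((y t - y h) / 2))"
      unfolding complex_diff_cis by (simp add: mult_ac)
  qed
  finally show ?thesis .
qed

section \<open>Eigenfunctions of the step operator\<close>

text \<open>The shift by (n - 1) / 2 makes the momenta of the indices b < n symmetric about 0 at
  \<open>\<psi> = 0\<close>. Increasing \<open>\<psi>\<close> by 1 amounts to increasing b by
  1.\<close>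

definition theta :: "nat \<Rightarrow> nat \<Rightarrow> real \<Rightarrow> nat \<Rightarrow> real" where
  "theta n m \<psi> b = 2 * pi * (real b - (real n - 1) / 2 + \<psi>) / real m"

text \<open>The matrix is indexed from \<open>0\<close>, the coordinates of points from \<open>1\<close>.\<close>
definition slater :: "nat \<Rightarrow> nat \<Rightarrow> real \<Rightarrow> (nat \<Rightarrow> nat) \<Rightarrow> (nat \<Rightarrow> real) \<Rightarrow> complex" where
  "slater n m \<psi> a x = Determinant.det (Matrix.mat n n (\<lambda>(l, j). cis (- (theta n m \<psi> (a j) * x (Suc l)))))"

lemma slater_eq_sum:
  "slater n m \<psi> a x = (\<Sum>p | p permutes {0..<n}. of_int (sign p) *
      (\<Prod>l=0..<n. cis (- (theta n m \<psi> (a (p l)) * x (Suc l)))))"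
  unfolding slater_def det_def'[OF mat_carrier]
proof (intro sum.cong refl arg_cong2[of _ _ _ _ "(*)"] prod.cong)
  fix p l assume "p \<in> {p. p permutes {0..<n}}" "l \<in> {0..<n}"
  then have "l < n" "p l < n" using permutes_in_image[of p "{0..<n}" l] by auto
  then show "Matrix.mat n n (\<lambda>(l, j). cis (- (theta n m \<psi> (a j) * x (Suc l)))) $$ (l, p l) =
    cis (- (theta n m \<psi> (a (p l)) * x (Suc l)))" by simp
qed

text \<open>Each permutation summand is already an eigenfunction, and its eigenvalue, a product over
  all momenta, does not depend on the permutation.\<close>

lemma sum_slater_diagonal_steps:
  "(\<Sum>s\<in>diagonal_steps n. slater n m \<psi> a (x - s)) =
    of_real (\<Prod>j=0..<n. 2 * cos (theta n m \<psi> (a j) / 2)) * slater n m \<psi> a x"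
proof -
  let ?\<theta> = "\<lambda>j. theta n m \<psi> (a j)"
  have two_cos: "cis (u / 2) + cis (- (u / 2)) = of_real (2 * cos (u / 2))" for u
    by (simp add: complex_eq_iff)
  have "(\<Sum>s\<in>diagonal_steps n. \<Prod>l=0..<n. cis (- (?\<theta> (p l) * (x - s) (Suc l)))) =
      of_real (\<Prod>j=0..<n. 2 * cos (?\<theta> j / 2)) * (\<Prod>l=0..<n. cis (- (?\<theta> (p l) * x (Suc l))))"
    if p: "p permutes {0..<n}" for p
  proof -
    have "(\<Sum>s\<in>diagonal_steps n. \<Prod>l=0..<n. cis (- (?\<theta> (p l) * (x - s) (Suc l)))) =
        (\<Sum>s\<in>diagonal_steps n. (\<Prod>l=0..<n. cis (- (?\<theta> (p l) * x (Suc l)))) *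
           (\<Prod>l=0..<n. cis (?\<theta> (p l) * s (Suc l))))"
      unfolding prod.distrib[symmetric] by (simp add: cis_mult algebra_simps)
    also have "\<dots> = (\<Prod>l=0..<n. cis (- (?\<theta> (p l) * x (Suc l)))) *
        (\<Prod>l=0..<n. of_real (2 * cos (?\<theta> (p l) / 2)))"
      unfolding sum_distrib_left[symmetric]
      using two_cos by (subst sum_prod_diagonal_steps) (simp add: mult.commute[of _ "1/2"])
    also have "(\<Prod>l=0..<n. complex_of_real (2 * cos (?\<theta> (p l) / 2))) = (\<Prod>j=0..<n. of_real (2 * cos (?\<theta> j / 2)))"
      using prod.permute[OF p, of "\<lambda>j. complex_of_real (2 * cos (?\<theta> j / 2))"] by (simp add: o_def)
    finally show ?thesis by (simp add: mult.commute)
  qed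
  then show ?thesis
    unfolding slater_eq_sum
    by (subst sum.swap) (simp add: sum_distrib_left mult_ac flip: sum_distrib_left[of "of_int _"])
qed

text \<open>This lets the spectral sums run over all functions \<open>a\<close>, injective or not,
  so that they factor over the coordinates.\<close>

lemma slater_eq_0_columns:
  assumes "\<not> inj_on a {0..<n}"
  shows "slater n m \<psi> a x = 0"
proof -
  obtain i j where "i < n" "j < n" "i \<noteq> j" "a i = a j"
    using assms by (auto simp: inj_on_def)
  then show ?thesis unfolding slater_def
    by (intro det_identical_columns[of _ n i j]) auto
qed

lemma slater_eq_0_wall:
  assumes "l \<in> {1..<n}" "x l = x (l + 1)"
  shows "slater n m \<psi> a x = 0"
  unfolding slater_def
  by (rule det_proportional_rows[of "l - 1" n l _ 1]) (use assms in auto)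

text \<open>Translating a coordinate by m multiplies each plane wave by a phase that is the same for
  all momenta of the coset, so the first and last rows are proportional.\<close>

lemma slater_eq_0_affine_wall:
  assumes "n \<ge> 1" "m \<ge> 1" "x n = x 1 - real m"
  shows "slater n m \<psi> a x = 0"
  unfolding slater_def
proof (rule det_proportional_rows[of 0 n "n - 1" _ "cis (2 * pi * (\<psi> - (real n - 1) / 2))"])
  \<comment> \<open>For n = 1 the wall condition would read
    \<open>x 1 = x 1 - real m\<close>.\<close>
  show "0 \<noteq> n - 1" using assms by (cases "n = 1") auto
  fix j assume "j < n"
  have "theta n m \<psi> (a j) * (x 1 - real m) = theta n m \<psi> (a j) * x 1 -
      (2 * pi * (\<psi> - (real n - 1) / 2) + 2 * pi * real (a j))"
    using assms by (simp add: theta_def field_simps)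
  then have "cis (- (theta n m \<psi> (a j) * (x 1 - real m))) =
    cis (2 * pi * (\<psi> - (real n - 1) / 2)) * cis (2 * pi * real (a j)) * cis (- (theta n m \<psi> (a j) * x 1))"
    unfolding cis_mult by (simp add: algebra_simps)
  moreover have "cis (2 * pi * real (a j)) = 1"
    using cis_multiple_2pi[of "real (a j)"] by simp
  ultimately show "cis (- (theta n m \<psi> (a j) * x (Suc (n - 1)))) =
      cis (2 * pi * (\<psi> - (real n - 1) / 2)) * cis (- (theta n m \<psi> (a j) * x (Suc 0)))"
    using assms by simp
qed (use assms in auto)

text \<open>The wave in \<open>\<eta>\<close> is a plain product, not a determinant: letting
  \<open>a\<close> run over all orderings of a set of momenta antisymmetrises it, without a division
  by n!.\<close>

definition spectral_integrand ::
    "nat \<Rightarrow> nat \<Rightarrow> (nat \<Rightarrow> real) \<Rightarrow> nat \<Rightarrow> (nat \<Rightarrow> real) \<Rightarrow> real \<Rightarrow> complex" where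
  "spectral_integrand n m \<eta> k x \<psi> = (\<Sum>a\<in>PiE {0..<n} (\<lambda>_. {0..<m}).
     of_real (\<Prod>j=0..<n. 2 * cos (theta n m \<psi> (a j) / 2)) ^ k *
     (\<Prod>j=0..<n. cis (theta n m \<psi> (a j) * \<eta> (Suc j))) * slater n m \<psi> a x)"

lemma sum_spectral_integrand_diagonal_steps:
  "(\<Sum>s\<in>diagonal_steps n. spectral_integrand n m \<eta> k (x - s) \<psi>) = spectral_integrand n m \<eta> (Suc k) x \<psi>"
  unfolding spectral_integrand_def
  by (subst sum.swap, unfold sum_distrib_left[symmetric] sum_slater_diagonal_steps)
     (simp add: mult_ac)

text \<open>Discrete orthogonality: \<open>z\<close> is an m-th root of unity because
  \<open>y\<close> is an integer, so its geometric sum is m or 0. The surviving phase carries the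
  dependence on \<open>\<psi>\<close> that is integrated later.\<close>

lemma sum_cis_theta:
  assumes "m \<ge> 1" "y \<in> \<int>"
  shows "(\<Sum>b=0..<m. cis (theta n m \<psi> b * y)) =
    (if y / real m \<in> \<int> then real m * cis (2 * pi * (\<psi> - (real n - 1) / 2) * (y / real m)) else 0)"
proof -
  define z where "z = cis (2 * pi * (y / real m))"
  define c where "c = cis (2 * pi * (\<psi> - (real n - 1) / 2) * (y / real m))"
  have "cis (theta n m \<psi> b * y) = c * z ^ b" for b
    unfolding z_def c_def Complex.DeMoivre cis_mult using assms
    by (intro arg_cong[where f = cis]) (simp add: theta_def field_simps)
  then have sum: "(\<Sum>b=0..<m. cis (theta n m \<psi> b * y)) = c * (\<Sum>b<m. z ^ b)"
    by (simp add: sum_distrib_left lessThan_atLeast0)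
  have zm: "z ^ m = 1"
    using assms cis_multiple_2pi[of y] by (simp add: z_def Complex.DeMoivre)
  show ?thesis
  proof (cases "y / real m \<in> \<int>")
    case True
    then have "z = 1" unfolding z_def by (rule cis_multiple_2pi)
    then show ?thesis using True sum by (simp add: c_def)
  next
    case False
    have "z \<noteq> 1"
    proof
      assume "z = 1"
      then obtain i :: int where "2 * pi * (y / real m) = 2 * pi * of_int i"
        by (auto simp: z_def complex_eq_iff cos_one_2pi_int mult_ac)
      then have "y / real m = of_int i"
        by (rule mult_left_cancel[of "2 * pi", THEN iffD1, rotated]) simp
      then show False using False by simp
    qed
    then have "(\<Sum>b<m. z ^ b) = 0" using zm by (simp add: sum_gp_strict)
    then show ?thesis using False sum by simp
  qed
qed

section \<open>The initial condition\<close>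

lemma alcove_less:
  assumes "x \<in> alcove n r" "1 \<le> i" "i < j" "j \<le> n"
  shows "x j < x i"
proof -
  have "Suc i \<le> j" using assms by simp
  then show ?thesis using assms(4)
  proof (induction j rule: dec_induct)
    case base
    then show ?case using assms(1,2) by (auto simp: alcove_def)
  next
    case (step j)
    have "x (j + 1) < x j" using assms(1,2) step by (auto simp: alcove_def)
    then show ?case using step by simp
  qed
qed

lemma alcove_diff_less:
  assumes "x \<in> alcove n r" "i \<in> {1..n}" "j \<in> {1..n}"
  shows "x i - x j < r"
proof -
  have "x i \<le> x 1" using alcove_less[OF assms(1), of 1 i] assms(2) by (cases "i = 1") auto
  moreover have "x n \<le> x j" using alcove_less[OF assms(1), of j n] assms(3) by (cases "j = n") auto
  ultimately show ?thesis using assms(1) by (auto simp: alcove_def)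
qed

lemma strict_mono_on_permutes_eq_id:
  fixes p :: "nat \<Rightarrow> nat"
  assumes "p permutes {0..<n}" "\<And>i j. i < j \<Longrightarrow> j < n \<Longrightarrow> p i < p j"
  shows "p = id"
proof (rule permutes_natset_ge[OF assms(1)], intro ballI)
  fix i assume "i \<in> {0..<n}"
  then have "i < n" by simp
  then show "i \<le> p i"
  proof (induction i)
    case (Suc i)
    then show ?case using assms(2)[of i "Suc i"] by simp
  qed simp
qed

text \<open>The alcove is a fundamental domain for permutations combined with shifts by multiples of
  m of total 0. If some \<open>r i \<ge> 1\<close> and some \<open>r j \<le> -1\<close>, a
  difference of coordinates of \<open>y\<close> plus one of \<open>x\<close> would be at least 2m,
  while each is below m. So all shifts have one sign and, having sum 0, vanish; then
  \<open>p\<close> preserves the order of the coordinates.\<close>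

lemma alcove_cong_permuted_imp_eq:
  assumes x: "x \<in> alcove n (real m)" and y: "y \<in> alcove n (real m)" and m: "m \<ge> 1"
    and p: "p permutes {0..<n}"
    and cong: "\<And>j. j < n \<Longrightarrow> (y (Suc j) - x (Suc (p j))) / real m \<in> \<int>"
    and sum: "(\<Sum>j=0..<n. x (Suc j)) = (\<Sum>j=0..<n. y (Suc j))"
  shows "p = id \<and> x = y"
proof -
  define r where "r j = (y (Suc j) - x (Suc (p j))) / real m" for j
  have r_Int: "r j \<in> \<int>" if "j < n" for j using cong[OF that] by (simp add: r_def)
  have y_eq: "y (Suc j) = x (Suc (p j)) + real m * r j" for j
    using m by (simp add: r_def)
  have p_less: "p j < n" if "j < n" for j
    using permutes_in_image[OF p, of j] that by simp
  have "(\<Sum>j=0..<n. y (Suc j)) = (\<Sum>j=0..<n. x (Suc (p j))) + real m * (\<Sum>j=0..<n. r j)"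
    by (simp add: y_eq sum.distrib sum_distrib_left)
  also have "(\<Sum>j=0..<n. x (Suc (p j))) = (\<Sum>j=0..<n. x (Suc j))"
    using sum.permute[OF p, of "\<lambda>j. x (Suc j)"] by (simp add: o_def)
  finally have sum_r: "(\<Sum>j=0..<n. r j) = 0" using sum m by simp
  have no_gap: False if "i < n" "j < n" "r i \<ge> 1" "r j \<le> -1" for i j
  proof -
    have "y (Suc i) - y (Suc j) < real m"
      by (rule alcove_diff_less[OF y]) (use that in auto)
    moreover have "x (Suc (p j)) - x (Suc (p i)) < real m"
      by (rule alcove_diff_less[OF x]) (use that p_less in \<open>auto simp: Suc_le_eq\<close>)
    moreover have "real m * r i \<ge> real m * 1" "real m * r j \<le> real m * (-1)"
      using that by (intro mult_left_mono; simp)+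
    ultimately show False unfolding y_eq by simp
  qed
  have pos: "r j \<ge> 1" if "j < n" "r j > 0" for j
    using r_Int[OF that(1)] that(2) by (auto elim!: Ints_cases)
  have neg: "r j \<le> -1" if "j < n" "r j < 0" for j
    using r_Int[OF that(1)] that(2) by (auto elim!: Ints_cases)
  have r0: "r j = 0" if "j < n" for j
  proof (rule ccontr)
    assume "r j \<noteq> 0"
    then consider "\<forall>i<n. r i \<ge> 0" | "\<forall>i<n. r i \<le> 0"
      using no_gap pos neg by (meson linorder_not_less)
    then have "\<forall>i\<in>{0..<n}. r i = 0"
    proof cases
      case 1
      then show ?thesis using sum_r by (subst (asm) sum_nonneg_eq_0_iff) auto
    next
      case 2
      then have "(\<Sum>i=0..<n. - r i) = 0 \<longleftrightarrow> (\<forall>i\<in>{0..<n}. - r i = 0)"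
        by (intro sum_nonneg_eq_0_iff) auto
      then show ?thesis using sum_r by (simp add: sum_negf)
    qed
    with \<open>r j \<noteq> 0\<close> that show False by simp
  qed
  then have eq: "y (Suc j) = x (Suc (p j))" if "j < n" for j
    using that by (simp add: y_eq)
  have "p = id"
  proof (rule strict_mono_on_permutes_eq_id[OF p])
    fix i j assume ij: "i < j" "j < n"
    have "x (Suc (p j)) < x (Suc (p i))"
      using alcove_less[OF y, of "Suc i" "Suc j"] ij by (simp add: eq)
    then show "p i < p j"
      using alcove_less[OF x, of "Suc (p j)" "Suc (p i)"] p_less[of i] ij
      by (cases "p i" "p j" rule: linorder_cases) auto
  qed
  moreover have "x j = y j" for j
  proof (cases "j \<in> {1..n}")
    case True
    then show ?thesis using eq[of "j - 1"] \<open>p = id\<close> by (cases j) auto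
  qed (use x y in \<open>auto simp: alcove_def Rspace_def\<close>)
  ultimately show ?thesis by (auto simp: fun_eq_iff)
qed

text \<open>Once the determinant is expanded, the sum over \<open>a\<close> factors into n
  orthogonality sums, so only permutations matching the two points modulo m survive. Their phases
  coincide because a permutation preserves the coordinate sum.\<close>

lemma spectral_integrand_0:
  assumes m: "m \<ge> 1" and Int: "\<And>i j. i < n \<Longrightarrow> j < n \<Longrightarrow> \<eta> (Suc i) - x (Suc j) \<in> \<int>"
  shows "spectral_integrand n m \<eta> 0 x \<psi> =
    of_int (\<Sum>p | p permutes {0..<n} \<and> (\<forall>j<n. (\<eta> (Suc j) - x (Suc (p j))) / real m \<in> \<int>). sign p) *
    real m ^ n * cis (2 * pi * (\<psi> - (real n - 1) / 2) * ((\<Sum>j=0..<n. \<eta> (Suc j)) - (\<Sum>j=0..<n. x (Suc j))) / real m)"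
proof -
  let ?c = "2 * pi * (\<psi> - (real n - 1) / 2)"
  let ?S = "(\<Sum>j=0..<n. \<eta> (Suc j)) - (\<Sum>j=0..<n. x (Suc j))"
  let ?Q = "\<lambda>p. \<forall>j<n. (\<eta> (Suc j) - x (Suc (p j))) / real m \<in> \<int>"
  have summand: "(\<Sum>a\<in>PiE {0..<n} (\<lambda>_. {0..<m}). (\<Prod>j=0..<n. cis (theta n m \<psi> (a j) * \<eta> (Suc j))) *
       (\<Prod>l=0..<n. cis (- (theta n m \<psi> (a (Hilbert_Choice.inv p l)) * x (Suc l))))) =
      (if ?Q p then real m ^ n * cis (?c * ?S / real m) else 0)" (is "?lhs = _")
    if p: "p permutes {0..<n}" for p
  proof -
    have "(\<Prod>l=0..<n. cis (- (theta n m \<psi> (a (Hilbert_Choice.inv p l)) * x (Suc l)))) =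
        (\<Prod>l=0..<n. cis (- (theta n m \<psi> (a l) * x (Suc (p l)))))" for a
      using prod.permute[OF p, of "\<lambda>l. cis (- (theta n m \<psi> (a (Hilbert_Choice.inv p l)) * x (Suc l)))"]
      by (simp add: o_def permutes_inverses[OF p])
    then have "?lhs = (\<Sum>a\<in>PiE {0..<n} (\<lambda>_. {0..<m}).
        \<Prod>j=0..<n. cis (theta n m \<psi> (a j) * (\<eta> (Suc j) - x (Suc (p j)))))"
      by (simp add: prod.distrib[symmetric] cis_mult algebra_simps)
    also have "\<dots> = (\<Prod>j=0..<n. \<Sum>b=0..<m. cis (theta n m \<psi> b * (\<eta> (Suc j) - x (Suc (p j)))))"
      by (rule prod_sum_PiE[symmetric]) auto
    also have "\<dots> = (\<Prod>j=0..<n. if (\<eta> (Suc j) - x (Suc (p j))) / real m \<in> \<int>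
        then real m * cis (?c * ((\<eta> (Suc j) - x (Suc (p j))) / real m)) else 0)"
      using permutes_in_image[OF p] by (intro prod.cong refl sum_cis_theta m Int) auto
    also have "\<dots> = (if ?Q p then real m ^ n * cis (?c * ?S / real m) else 0)"
    proof (cases "?Q p")
      case True
      have "(\<Prod>j=0..<n. cis (?c * ((\<eta> (Suc j) - x (Suc (p j))) / real m))) =
          cis (\<Sum>j=0..<n. ?c * ((\<eta> (Suc j) - x (Suc (p j))) / real m))"
        by (simp add: cis_conv_exp exp_sum sum_distrib_left)
      also have "(\<Sum>j=0..<n. ?c * ((\<eta> (Suc j) - x (Suc (p j))) / real m)) = ?c * ?S / real m"
        using sum.permute[OF p, of "\<lambda>j. x (Suc j)"]
        by (simp add: o_def sum_subtractf flip: sum_distrib_left sum_divide_distrib)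
      finally show ?thesis using True by (simp add: prod.distrib)
    next
      case False
      then show ?thesis by (auto intro!: prod_zero)
    qed
    finally show ?thesis .
  qed
  have "spectral_integrand n m \<eta> 0 x \<psi> = (\<Sum>p | p permutes {0..<n}. of_int (sign p) *
     (\<Sum>a\<in>PiE {0..<n} (\<lambda>_. {0..<m}). (\<Prod>j=0..<n. cis (theta n m \<psi> (a j) * \<eta> (Suc j))) *
       (\<Prod>l=0..<n. cis (- (theta n m \<psi> (a (p l)) * x (Suc l))))))"
    unfolding spectral_integrand_def slater_eq_sum sum_distrib_left
    by (subst sum.swap) (simp add: mult_ac)
  \<comment> \<open>With the inverse permutation both products can be written over the argument of
    \<open>a\<close>, which is what makes the sum over \<open>a\<close> factor.\<close>
  also have "\<dots> = (\<Sum>p | p permutes {0..<n}. of_int (sign (Hilbert_Choice.inv p)) *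
     (\<Sum>a\<in>PiE {0..<n} (\<lambda>_. {0..<m}). (\<Prod>j=0..<n. cis (theta n m \<psi> (a j) * \<eta> (Suc j))) *
       (\<Prod>l=0..<n. cis (- (theta n m \<psi> (a (Hilbert_Choice.inv p l)) * x (Suc l))))))"
    by (rule sum_permutations_inverse)
  also have "\<dots> = (\<Sum>p | p permutes {0..<n}. of_int (sign p) *
      (if ?Q p then real m ^ n * cis (?c * ?S / real m) else 0))"
    by (intro sum.cong refl arg_cong2[of _ _ _ _ "(*)"] summand)
       (auto simp: sign_inverse permutes_imp_permutation[of "{0..<n}"])
  also have "\<dots> = (\<Sum>p | p permutes {0..<n} \<and> ?Q p. of_int (sign p) * (real m ^ n * cis (?c * ?S / real m)))"
    by (rule sum.mono_neutral_cong_right) (auto simp: finite_permutations)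
  finally show ?thesis by (simp add: sum_distrib_right mult.assoc)
qed

section \<open>The integral formula for the number of walks\<close>

lemma continuous_on_theta [continuous_intros]:
  "continuous_on A f \<Longrightarrow> continuous_on A (\<lambda>x. theta n m (f x) b)"
  unfolding theta_def divide_inverse by (intro continuous_intros)

lemma continuous_on_slater [continuous_intros]:
  "continuous_on A (\<lambda>\<psi>. slater n m \<psi> a x)"
  unfolding slater_eq_sum by (intro continuous_intros)

lemma continuous_on_spectral_integrand: "continuous_on A (spectral_integrand n m \<eta> k x)"
  unfolding spectral_integrand_def by (intro continuous_intros) auto

text \<open>At time 0 each of the n sums over a momentum contributes a factor m, whence the
  normalisation. The period is centred so that the point \<open>\<psi> = 0\<close> of the maximal
  eigenvalue is interior.\<close>

definition spectral_count :: "nat \<Rightarrow> nat \<Rightarrow> (nat \<Rightarrow> real) \<Rightarrow> nat \<Rightarrow> (nat \<Rightarrow> real) \<Rightarrow> complex" where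
  "spectral_count n m \<eta> k x = (1 / of_nat m ^ n) *
     (\<integral>\<psi>. indicator {-(1/2)..1/2} \<psi> *\<^sub>R spectral_integrand n m \<eta> k x \<psi> \<partial>lborel)"

lemma integral_cis_full_period:
  fixes N c :: real
  assumes "N \<in> \<int>" "N \<noteq> 0"
  shows "(\<integral>\<psi>. indicator {-(1/2)..1/2} \<psi> *\<^sub>R cis (2 * pi * (\<psi> - c) * N) \<partial>lborel) = 0"
proof -
  let ?F = "\<lambda>\<psi>. cis (2 * pi * (\<psi> - c) * N) / (\<i> * of_real (2 * pi * N))"
  have "(\<integral>\<psi>. indicator {-(1/2)..1/2} \<psi> *\<^sub>R cis (2 * pi * (\<psi> - c) * N) \<partial>lborel) = ?F (1/2) - ?F (-(1/2))"
  proof (rule integral_FTC_atLeastAtMost)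
    fix \<psi> :: real
    show "(?F has_vector_derivative cis (2 * pi * (\<psi> - c) * N)) (at \<psi> within {-(1/2)..1/2})"
    proof -
      have "((\<lambda>\<psi>. cis (2 * pi * (\<psi> - c) * N)) has_derivative
          (\<lambda>t. (2 * pi * t * N) *\<^sub>R (\<i> * cis (2 * pi * (\<psi> - c) * N)))) (at \<psi> within {-(1/2)..1/2})"
        by (auto intro!: derivative_eq_intros)
      from has_derivative_divide[OF this has_derivative_const[of "\<i> * of_real (2 * pi * N)"]] assms
      show ?thesis unfolding has_vector_derivative_def
        by (simp add: scaleR_conv_of_real mult_ac)
    qed
  qed (simp, intro continuous_intros)
  also have "cis (2 * pi * (1/2 - c) * N) = cis (2 * pi * (-(1/2) - c) * N + 2 * pi * N)"
    by (simp add: algebra_simps)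
  also have "\<dots> = cis (2 * pi * (-(1/2) - c) * N)"
    unfolding cis_mult[symmetric] using assms(1) by simp
  finally show ?thesis by simp
qed

text \<open>If the coordinate sums agree, only the identity can contribute. If they differ by
  \<open>D\<close>, a contributing permutation forces \<open>D\<close> to be a nonzero multiple of
  m, and the phase integrates to 0 over a full period.\<close>

lemma spectral_count_0:
  assumes m: "m \<ge> 1" and x: "x \<in> alcove n (real m)" and \<eta>: "\<eta> \<in> alcove n (real m)"
    and Int: "\<And>i j. i < n \<Longrightarrow> j < n \<Longrightarrow> \<eta> (Suc i) - x (Suc j) \<in> \<int>"
  shows "spectral_count n m \<eta> 0 x = (if x = \<eta> then 1 else 0)"
proof -
  define Q where "Q = {p. p permutes {0..<n} \<and> (\<forall>j<n. (\<eta> (Suc j) - x (Suc (p j))) / real m \<in> \<int>)}"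
  define D where "D = (\<Sum>j=0..<n. \<eta> (Suc j)) - (\<Sum>j=0..<n. x (Suc j))"
  have integrand: "spectral_integrand n m \<eta> 0 x = (\<lambda>\<psi>. of_int (\<Sum>p\<in>Q. sign p) *
     real m ^ n * cis (2 * pi * (\<psi> - (real n - 1) / 2) * (D / real m)))"
    unfolding Q_def D_def by (intro ext, subst spectral_integrand_0[OF m]) (use Int in simp_all)
  show ?thesis
  proof (cases "D = 0")
    case True
    have "Q = (if x = \<eta> then {id} else {})"
    proof (intro Set.set_eqI iffI)
      fix p assume "p \<in> Q"
      then have "p = id \<and> x = \<eta>"
        using True by (intro alcove_cong_permuted_imp_eq[OF x \<eta> m]) (auto simp: Q_def D_def)
      then show "p \<in> (if x = \<eta> then {id} else {})" by simp
    qed (auto simp: Q_def permutes_id split: if_splits)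
    then show ?thesis
      using True m unfolding spectral_count_def integrand by (auto simp: scaleR_conv_of_real)
  next
    case False
    then have "x \<noteq> \<eta>" by (auto simp: D_def)
    show ?thesis
    proof (cases "Q = {}")
      case True
      then show ?thesis using \<open>x \<noteq> \<eta>\<close> unfolding spectral_count_def integrand by simp
    next
      case False
      then obtain p where p: "p permutes {0..<n}"
        and pQ: "\<And>j. j < n \<Longrightarrow> (\<eta> (Suc j) - x (Suc (p j))) / real m \<in> \<int>"
        by (auto simp: Q_def)
      have "(\<Sum>j=0..<n. (\<eta> (Suc j) - x (Suc (p j))) / real m) \<in> \<int>"
        using pQ by (intro Ints_sum) auto
      also have "(\<Sum>j=0..<n. (\<eta> (Suc j) - x (Suc (p j))) / real m) = D / real m"
        using sum.permute[OF p, of "\<lambda>j. x (Suc j)"]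
        by (simp add: o_def sum_subtractf D_def flip: sum_divide_distrib)
      finally have "(\<integral>\<psi>. indicator {-(1/2)..1/2} \<psi> *\<^sub>R
          cis (2 * pi * (\<psi> - (real n - 1) / 2) * (D / real m)) \<partial>lborel) = 0"
        using \<open>D \<noteq> 0\<close> m by (intro integral_cis_full_period) auto
      moreover have "(\<integral>\<psi>. indicator {-(1/2)..1/2::real} \<psi> *\<^sub>R (K * f \<psi>) \<partial>lborel) =
          K * (\<integral>\<psi>. indicator {-(1/2)..1/2::real} \<psi> *\<^sub>R f \<psi> \<partial>lborel)" for K :: complex and f :: "real \<Rightarrow> complex"
        using integral_mult_right_zero[of lborel K "\<lambda>\<psi>. indicator {-(1/2)..1/2::real} \<psi> *\<^sub>R f \<psi>"] by simp
      ultimately show ?thesis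
        using \<open>x \<noteq> \<eta>\<close> by (simp only: spectral_count_def integrand) simp
    qed
  qed
qed

lemma spectral_count_Suc:
  "spectral_count n m \<eta> (Suc k) x = (\<Sum>s\<in>diagonal_steps n. spectral_count n m \<eta> k (x - s))"
proof -
  have int: "integrable lborel (\<lambda>\<psi>. indicator {-(1/2)..1/2} \<psi> *\<^sub>R spectral_integrand n m \<eta> k y \<psi>)" for y
    using borel_integrable_atLeastAtMost'[OF continuous_on_spectral_integrand]
    by (simp add: set_integrable_def)
  show ?thesis
    unfolding spectral_count_def sum_spectral_integrand_diagonal_steps[symmetric]
      sum_distrib_left[symmetric] scaleR_sum_right
    using int by (subst Bochner_Integration.integral_sum) auto
qed

lemma of_nat_card_walks_eq_spectral_count:
  assumes n: "n \<ge> 1" and m: "m \<ge> 1"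
    and \<eta>: "\<eta> \<in> alcove n (real m)" and x: "x \<in> alcove n (real m)"
    and \<eta>_Int: "\<forall>l\<in>{1..n}. \<forall>l'\<in>{1..n}. \<eta> l - \<eta> l' \<in> \<int>"
    and x_Int: "\<forall>l\<in>{1..n}. x l - \<eta> l - real k / 2 \<in> \<int>"
  shows "of_nat (card (walks (diagonal_steps n) (alcove n (real m)) \<eta> x k)) = spectral_count n m \<eta> k x"
proof (rule of_nat_card_walks_eqI[where W = "spectral_count n m \<eta>", OF spectral_count_Suc _ _ _ \<eta> \<eta>_Int n x x_Int])
  fix y assume y: "y \<in> alcove n (real m)" and y_Int: "\<forall>l\<in>{1..n}. y l - \<eta> l \<in> \<int>"
  show "spectral_count n m \<eta> 0 y = (if y = \<eta> then 1 else 0)"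
  proof (rule spectral_count_0[OF m y \<eta>])
    fix i j assume ij: "i < n" "j < n"
    have "(\<eta> (Suc i) - \<eta> (Suc j)) - (y (Suc j) - \<eta> (Suc j)) \<in> \<int>"
      by (rule Ints_diff) (use ij \<eta>_Int y_Int in \<open>auto simp: Suc_le_eq\<close>)
    then show "\<eta> (Suc i) - y (Suc j) \<in> \<int>" by simp
  qed
qed (simp_all add: spectral_count_def spectral_integrand_def slater_eq_0_wall slater_eq_0_affine_wall[OF n m])

section \<open>The dominant eigenvalue\<close>

text \<open>The common factors cancel, and \<open>A - B\<close> and \<open>B - A\<close> have the
  same number \<open>d\<close> of elements, so the products are compared through
  \<open>q ^ d\<close> and \<open>r ^ d\<close>.\<close>

lemma
  fixes g :: "'a \<Rightarrow> real"
  assumes fin: "finite A" "finite B" and card: "card A = card B"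
    and nonneg: "\<And>x. x \<in> A \<union> B \<Longrightarrow> 0 \<le> g x"
    and upper: "\<And>x. x \<in> A - B \<Longrightarrow> g x \<le> q" and lower: "\<And>x. x \<in> B - A \<Longrightarrow> r \<le> g x"
    and q: "0 \<le> q" "q \<le> r"
  shows prod_exchange_le: "prod g A \<le> prod g B"
    and prod_exchange_less: "A \<noteq> B \<Longrightarrow> q < r \<Longrightarrow> (\<And>x. x \<in> B \<Longrightarrow> 0 < g x) \<Longrightarrow> prod g A < prod g B"
proof -
  define d where "d = card (A - B)"
  have split: "prod g A = prod g (A \<inter> B) * prod g (A - B)" "prod g B = prod g (A \<inter> B) * prod g (B - A)"
    using fin prod.Int_Diff[of A g B] prod.Int_Diff[of B g A] by (simp_all add: Int_commute)
  have "card (A - B) + card (A \<inter> B) = card (B - A) + card (A \<inter> B)"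
    using fin card card_Diff_subset_Int[of A B] card_Diff_subset_Int[of B A]
      card_mono[of A "A \<inter> B"] card_mono[of B "A \<inter> B"] by (simp add: Int_commute)
  then have d: "card (B - A) = d" by (simp add: d_def)
  have A_le: "prod g (A - B) \<le> q ^ d"
    using prod_mono[of "A - B" g "\<lambda>_. q"] nonneg upper by (simp add: d_def)
  have B_ge: "r ^ d \<le> prod g (B - A)"
    using prod_mono[of "B - A" "\<lambda>_. r" g] q lower d by simp
  have I: "0 \<le> prod g (A \<inter> B)" using nonneg by (intro prod_nonneg) auto
  have "q ^ d \<le> r ^ d" using q by (intro power_mono)
  with A_le B_ge show "prod g A \<le> prod g B"
    unfolding split using I by (intro mult_left_mono) auto
  show "prod g A < prod g B" if "A \<noteq> B" "q < r" "\<And>x. x \<in> B \<Longrightarrow> 0 < g x"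
  proof -
    have "d > 0"
    proof (rule ccontr)
      assume "\<not> d > 0"
      then have "A - B = {}" using fin by (simp add: d_def)
      then show False using \<open>A \<noteq> B\<close> card_subset_eq[OF fin(2) _ card] by blast
    qed
    then have "q ^ d < r ^ d" using q that by (intro power_strict_mono) auto
    moreover have "0 < prod g (A \<inter> B)" using that by (intro prod_pos) auto
    ultimately show ?thesis unfolding split using A_le B_ge by (intro mult_strict_left_mono) auto
  qed
qed

section \<open>Bounds for the cosine factors of the eigenvalues\<close>

lemma cos_pi_div_ge:
  assumes "\<bar>u\<bar> \<le> e" "e \<le> m" "m > 0"
  shows "cos (pi * e / m) \<le> cos (pi * u / m)"
proof -
  have "cos (pi * e / m) \<le> cos \<bar>pi * u / m\<bar>"
    using assms by (intro cos_monotone_0_pi_le) (auto simp: abs_mult field_simps)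
  then show ?thesis unfolding cos_abs_real .
qed

lemma cos_pi_div_less:
  assumes "0 \<le> u" "u < e" "e \<le> m" "m > 0"
  shows "cos (pi * e / m) < cos (pi * u / m)"
  using assms by (intro cos_monotone_0_pi) (auto simp: field_simps)

lemma cos_pi_div_nonneg:
  assumes "\<bar>u\<bar> \<le> m / 2" "m > 0"
  shows "0 \<le> cos (pi * u / m)"
  using cos_pi_div_ge[of u "m / 2" m] assms by simp

lemma cos_pi_div_pos:
  assumes "\<bar>u\<bar> < m / 2" "m > 0"
  shows "0 < cos (pi * u / m)"
  using cos_pi_div_less[of "\<bar>u\<bar>" "m / 2" m] cos_pi_div_ge[of u "\<bar>u\<bar>" m] assms by simp

lemma abs_cos_pi_div_le:
  assumes "0 \<le> e" "e \<le> v" "v \<le> m - e" "m > 0"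
  shows "\<bar>cos (pi * v / m)\<bar> \<le> cos (pi * e / m)"
proof -
  have "pi * (m - e) / m = pi - pi * e / m"
    using assms by (simp add: field_simps)
  then have "cos (pi * (m - e) / m) = - cos (pi * e / m)" by (simp add: cos_diff)
  moreover have "cos (pi * (m - e) / m) \<le> cos (pi * v / m)"
    using assms by (intro cos_pi_div_ge) auto
  moreover have "cos (pi * v / m) \<le> cos (pi * e / m)"
    using assms by (intro cos_pi_div_ge) auto
  ultimately show ?thesis by linarith
qed

definition cosine :: "nat \<Rightarrow> nat \<Rightarrow> real \<Rightarrow> nat \<Rightarrow> real" where
  "cosine n m \<psi> b = cos (theta n m \<psi> b / 2)"

lemma cosine_eq: "cosine n m \<psi> b = cos (pi * (real b - (real n - 1) / 2 + \<psi>) / real m)"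
  by (simp add: cosine_def theta_def)

lemma cosine_inner:
  assumes "n \<le> m" "b < n" "\<bar>\<psi>\<bar> \<le> 1/2"
  shows "cos (pi * (real n / 2 - 1/2 + \<bar>\<psi>\<bar>) / real m) \<le> cosine n m \<psi> b"
  unfolding cosine_eq by (rule cos_pi_div_ge) (use assms in \<open>auto simp: abs_if field_simps\<close>)

text \<open>Both ends of the range matter: |cos| has period m in the index, so b = m - 1 behaves
  like b = -1. This bound and that of \<open>cosine_inner\<close> meet at |\<psi>| = 1/2.\<close>

lemma cosine_outer:
  assumes "n \<le> b" "b < m" "\<bar>\<psi>\<bar> \<le> 1/2"
  shows "\<bar>cosine n m \<psi> b\<bar> \<le> cos (pi * (real n / 2 + 1/2 - \<bar>\<psi>\<bar>) / real m)"
  unfolding cosine_eq by (rule abs_cos_pi_div_le) (use assms in \<open>auto simp: field_simps\<close>)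

lemma cosine_nonneg:
  assumes "n \<le> m" "b < n" "\<bar>\<psi>\<bar> \<le> 1/2"
  shows "0 \<le> cosine n m \<psi> b"
proof -
  have "0 \<le> cos (pi * (real n / 2 - 1/2 + \<bar>\<psi>\<bar>) / real m)"
    using assms by (intro cos_pi_div_nonneg) auto
  then show ?thesis using cosine_inner[OF assms] by simp
qed

lemma cosine_0_pos:
  assumes "n \<le> m" "b < n"
  shows "0 < cosine n m 0 b"
proof -
  have "0 < cos (pi * (real n / 2 - 1/2) / real m)"
    using assms by (intro cos_pi_div_pos) (auto simp: abs_if)
  then show ?thesis using cosine_inner[OF assms, of 0] by simp
qed

lemma abs_prod_cosine_le:
  assumes nm: "n \<le> m" and a: "a ` {0..<n} \<subseteq> {0..<m}" "inj_on a {0..<n}" and \<psi>: "\<bar>\<psi>\<bar> \<le> 1/2"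
  shows "\<bar>\<Prod>j=0..<n. cosine n m \<psi> (a j)\<bar> \<le> (\<Prod>b=0..<n. cosine n m \<psi> b)"
proof -
  \<comment> \<open>This value separates the inner from the outer bound for all |\<psi>| \<le> 1/2;
    both bounds equal it at |\<psi>| = 1/2, so the comparison is not strict.\<close>
  let ?q = "cos (pi * (real n / 2) / real m)"
  have "\<bar>\<Prod>j=0..<n. cosine n m \<psi> (a j)\<bar> = (\<Prod>b\<in>a ` {0..<n}. \<bar>cosine n m \<psi> b\<bar>)"
    using a(2) by (simp add: abs_prod prod.reindex)
  also have "\<dots> \<le> (\<Prod>b=0..<n. \<bar>cosine n m \<psi> b\<bar>)"
  proof (rule prod_exchange_le[of _ _ _ ?q ?q])
    fix b assume "b \<in> a ` {0..<n} - {0..<n}"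
    then have b: "n \<le> b" "b < m" using a(1) by auto
    have "cos (pi * (real n / 2 + 1/2 - \<bar>\<psi>\<bar>) / real m) \<le> ?q"
      using \<psi> b by (intro cos_pi_div_ge) (auto simp: abs_if)
    then show "\<bar>cosine n m \<psi> b\<bar> \<le> ?q" using cosine_outer[OF b \<psi>] by simp
  next
    fix b assume "b \<in> {0..<n} - a ` {0..<n}"
    then have b: "b < n" by auto
    have "?q \<le> cos (pi * (real n / 2 - 1/2 + \<bar>\<psi>\<bar>) / real m)"
      using \<psi> b nm by (intro cos_pi_div_ge) (auto simp: abs_if)
    then show "?q \<le> \<bar>cosine n m \<psi> b\<bar>" using cosine_inner[OF nm b \<psi>] by simp
  next
    show "0 \<le> ?q" using nm by (cases "m = 0") (auto intro!: cos_pi_div_nonneg)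
  qed (use a in \<open>auto simp: card_image\<close>)
  also have "\<dots> = (\<Prod>b=0..<n. cosine n m \<psi> b)"
    using cosine_nonneg[OF nm _ \<psi>] by (intro prod.cong) auto
  finally show ?thesis .
qed

lemma abs_prod_cosine_0_less:
  assumes nm: "n \<le> m" and a: "a ` {0..<n} \<subseteq> {0..<m}" "inj_on a {0..<n}" "a ` {0..<n} \<noteq> {0..<n}"
  shows "\<bar>\<Prod>j=0..<n. cosine n m 0 (a j)\<bar> < (\<Prod>b=0..<n. cosine n m 0 b)"
proof -
  \<comment> \<open>At \<open>\<psi> = 0\<close> the two thresholds lie a full unit apart, which
    makes the comparison strict.\<close>
  let ?q = "cos (pi * (real n / 2 + 1/2) / real m)" and ?r = "cos (pi * (real n / 2 - 1/2) / real m)"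
  have "card (a ` {0..<n}) = card {0..<n}" using a(2) by (simp add: card_image)
  then have "\<not> a ` {0..<n} \<subseteq> {0..<n}" using a(3) card_subset_eq[of "{0..<n}" "a ` {0..<n}"] by auto
  then have n: "n < m" "n > 0" using a(1) by auto
  have "\<bar>\<Prod>j=0..<n. cosine n m 0 (a j)\<bar> = (\<Prod>b\<in>a ` {0..<n}. \<bar>cosine n m 0 b\<bar>)"
    using a(2) by (simp add: abs_prod prod.reindex)
  also have "\<dots> < (\<Prod>b=0..<n. \<bar>cosine n m 0 b\<bar>)"
  proof (rule prod_exchange_less[of _ _ _ ?q ?r])
    fix b assume "b \<in> a ` {0..<n} - {0..<n}"
    then have b: "n \<le> b" "b < m" using a(1) by auto
    then show "\<bar>cosine n m 0 b\<bar> \<le> ?q" using cosine_outer[OF b, of 0] by simp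
  next
    fix b assume "b \<in> {0..<n} - a ` {0..<n}"
    then have b: "b < n" by auto
    then show "?r \<le> \<bar>cosine n m 0 b\<bar>" using cosine_inner[OF nm b, of 0] by simp
  next
    show "0 \<le> ?q" using n by (intro cos_pi_div_nonneg) auto
    show "?q < ?r" using n by (intro cos_pi_div_less) auto
    then show "?q \<le> ?r" by simp
  next
    fix b assume "b \<in> {0..<n}"
    then show "0 < \<bar>cosine n m 0 b\<bar>" using cosine_0_pos[OF nm, of b] by simp
  qed (use a in \<open>auto simp: card_image\<close>)
  also have "\<dots> = (\<Prod>b=0..<n. cosine n m 0 b)"
    using cosine_nonneg[OF nm, of _ 0] by (intro prod.cong) auto
  finally show ?thesis .
qed

text \<open>The centred momenta are symmetric about \<open>0\<close>, so pairing \<open>b\<close> with \<open>n - 1 - b\<close> turns the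
  square into factors \<open>cos (\<alpha> + \<epsilon>) * cos (\<alpha> - \<epsilon>) = cos\<^sup>2 \<alpha> - sin\<^sup>2 \<epsilon>\<close>; no second derivative of the
  logarithm is needed.\<close>
lemma prod_cosine_squared:
  assumes "n \<le> m"
  shows "((\<Prod>b=0..<n. cosine n m \<psi> b) / (\<Prod>b=0..<n. cosine n m 0 b))\<^sup>2 =
    (\<Prod>b=0..<n. 1 - (sin (pi * \<psi> / real m) / cosine n m 0 b)\<^sup>2)"
proof -
  have reflect: "cosine n m \<psi> (n - Suc b) = cosine n m (- \<psi>) b" if "b < n" for b
  proof -
    have eq: "real (n - Suc b) - (real n - 1) / 2 + \<psi> = - (real b - (real n - 1) / 2 + (- \<psi>))"
      using that by (simp add: of_nat_diff field_simps)
    show ?thesis unfolding cosine_eq eq by (metis cos_minus minus_divide_left mult_minus_right)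
  qed
  have two: "cosine n m \<psi> b * cosine n m (- \<psi>) b = (cosine n m 0 b)\<^sup>2 - (sin (pi * \<psi> / real m))\<^sup>2" for b
  proof -
    let ?\<alpha> = "pi * (real b - (real n - 1) / 2) / real m" and ?\<epsilon> = "pi * \<psi> / real m"
    have "cos (?\<alpha> + ?\<epsilon>) * cos (?\<alpha> - ?\<epsilon>) = (cos ?\<alpha>)\<^sup>2 * (cos ?\<epsilon>)\<^sup>2 - (sin ?\<alpha>)\<^sup>2 * (sin ?\<epsilon>)\<^sup>2"
      unfolding cos_add cos_diff by (simp add: algebra_simps power2_eq_square)
    also have "\<dots> = (cos ?\<alpha>)\<^sup>2 - (sin ?\<epsilon>)\<^sup>2"
      unfolding sin_squared_eq[of ?\<alpha>] cos_squared_eq[of ?\<epsilon>] by (simp add: algebra_simps)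
    finally show ?thesis
      unfolding cosine_eq by (simp add: algebra_simps add_divide_distrib diff_divide_distrib)
  qed
  have "(\<Prod>b=0..<n. cosine n m \<psi> b) = (\<Prod>b=0..<n. cosine n m (- \<psi>) b)"
    using prod.nat_diff_reindex[of "cosine n m \<psi>" n] reflect by (simp add: lessThan_atLeast0)
  then have "(\<Prod>b=0..<n. cosine n m \<psi> b)\<^sup>2 =
      (\<Prod>b=0..<n. cosine n m \<psi> b) * (\<Prod>b=0..<n. cosine n m (- \<psi>) b)"
    by (simp add: power2_eq_square)
  also have "\<dots> = (\<Prod>b=0..<n. (cosine n m 0 b)\<^sup>2 - (sin (pi * \<psi> / real m))\<^sup>2)"
    by (simp only: prod.distrib[symmetric] two)
  finally have "(\<Prod>b=0..<n. cosine n m \<psi> b)\<^sup>2 =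
      (\<Prod>b=0..<n. (cosine n m 0 b)\<^sup>2 - (sin (pi * \<psi> / real m))\<^sup>2)" .
  also have "\<dots> / (\<Prod>b=0..<n. cosine n m 0 b)\<^sup>2 =
      (\<Prod>b=0..<n. ((cosine n m 0 b)\<^sup>2 - (sin (pi * \<psi> / real m))\<^sup>2) / (cosine n m 0 b)\<^sup>2)"
    by (simp add: prod_dividef prod_power_distrib)
  also have "\<dots> = (\<Prod>b=0..<n. 1 - (sin (pi * \<psi> / real m) / cosine n m 0 b)\<^sup>2)"
  proof (intro prod.cong refl)
    fix b assume "b \<in> {0..<n}"
    then have "cosine n m 0 b \<noteq> 0" using cosine_0_pos[OF assms, of b] by simp
    then show "((cosine n m 0 b)\<^sup>2 - (sin (pi * \<psi> / real m))\<^sup>2) / (cosine n m 0 b)\<^sup>2 =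
        1 - (sin (pi * \<psi> / real m) / cosine n m 0 b)\<^sup>2"
      by (simp add: diff_divide_distrib power_divide)
  qed
  finally show ?thesis by (simp add: power_divide)
qed

text \<open>The constant c0 of the theorem. For n \<le> m, the logarithm of the product of the
  cosines over b < n has second derivative
  \<open>- 4 * pi\<^sup>2 * curvature n m / real m ^ 2\<close> in \<open>\<psi>\<close> at
  0.\<close>

definition curvature :: "nat \<Rightarrow> nat \<Rightarrow> real" where
  "curvature n m = (\<Sum>b=0..<n. 1 / (2 * cosine n m 0 b)\<^sup>2)"

lemma prod_cosine_0_pos: "n \<le> m \<Longrightarrow> 0 < (\<Prod>b=0..<n. cosine n m 0 b)"
  using cosine_0_pos by (intro prod_pos) auto

lemma curvature_nonneg: "0 \<le> curvature n m"
  unfolding curvature_def by (intro sum_nonneg) simp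

lemma curvature_pos: "0 < n \<Longrightarrow> n \<le> m \<Longrightarrow> 0 < curvature n m"
  unfolding curvature_def using cosine_0_pos by (intro sum_pos) force+

text \<open>Jordan's inequality: the concave sine lies above its chord on [0, pi/2].\<close>

lemma abs_sin_pi_ge:
  assumes "\<bar>x\<bar> \<le> 1/2"
  shows "2 * \<bar>x\<bar> \<le> \<bar>sin (pi * x)\<bar>"
proof -
  have main: "2 * y \<le> sin (pi * y)" if "0 \<le> y" "y \<le> 1/2" for y :: real
  proof -
    have "concave_on {0..pi/2} sin"
      by (rule f''_le0_imp_concave[where f' = cos and f'' = "\<lambda>x. - sin x"])
         (auto intro!: derivative_eq_intros sin_ge_zero)
    from concave_onD_Icc'[OF this, of "pi * y"] that
    show ?thesis by (auto simp: field_simps)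
  qed
  show ?thesis
  proof (cases "x \<ge> 0")
    case True
    then show ?thesis using main[of x] assms by simp
  next
    case False
    then show ?thesis using main[of "- x"] assms by simp
  qed
qed

text \<open>The factors of the squared ratio have the form 1 - u \<le> exp (-u), and Jordan's
  inequality bounds u from below. The constant 8 comes from halving 16 on taking the root; it is
  below the sharp value \<open>2 * pi\<^sup>2\<close>, which is enough for a dominating
  function.\<close>

lemma prod_cosine_ratio_le:
  assumes nm: "n \<le> m" and m: "m \<ge> 1" and \<psi>: "\<bar>\<psi>\<bar> \<le> 1/2"
  shows "(\<Prod>b=0..<n. cosine n m \<psi> b) / (\<Prod>b=0..<n. cosine n m 0 b) \<le>
    exp (- (8 * curvature n m / real m ^ 2) * \<psi>\<^sup>2)"
proof -
  let ?s = "sin (pi * \<psi> / real m)"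
  have "\<bar>\<psi> / real m\<bar> \<le> 1/2"
    using \<psi> m by (simp add: field_simps)
  from abs_sin_pi_ge[OF this] have "2 * \<bar>\<psi> / real m\<bar> \<le> \<bar>?s\<bar>" by simp
  then have "(2 * \<bar>\<psi> / real m\<bar>)\<^sup>2 \<le> \<bar>?s\<bar>\<^sup>2" by (intro power_mono) auto
  then have s: "4 * \<psi>\<^sup>2 / real m ^ 2 \<le> ?s\<^sup>2" by (simp add: power_mult_distrib power_divide)
  have "((\<Prod>b=0..<n. cosine n m \<psi> b) / (\<Prod>b=0..<n. cosine n m 0 b))\<^sup>2 \<le>
     (\<Prod>b=0..<n. exp (- (?s / cosine n m 0 b)\<^sup>2))"
    unfolding prod_cosine_squared[OF nm]
  proof (intro prod_mono conjI)
    fix b assume b: "b \<in> {0..<n}"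
    show "1 - (?s / cosine n m 0 b)\<^sup>2 \<le> exp (- (?s / cosine n m 0 b)\<^sup>2)"
      using exp_ge_add_one_self[of "- (?s / cosine n m 0 b)\<^sup>2"] by simp
    \<comment> \<open>Multiplying the inequalities requires nonnegative factors. The sine is the
      cosine belonging to m/2 - |\<psi>|, which is at least (n - 1)/2.\<close>
    have "\<bar>?s\<bar> \<le> cosine n m 0 b"
    proof -
      have "\<bar>?s\<bar> = sin (pi * \<bar>\<psi>\<bar> / real m)"
      proof -
        have "pi * \<bar>\<psi>\<bar> \<le> pi * real m" using m \<psi> by (intro mult_left_mono) auto
        then have "0 \<le> sin (pi * \<bar>\<psi>\<bar> / real m)"
          using m by (intro sin_ge_zero) (auto simp: field_simps)
        then show ?thesis by (cases "\<psi> \<ge> 0") simp_all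
      qed
      also have "\<dots> = cos (pi * (real m / 2 - \<bar>\<psi>\<bar>) / real m)"
        using m by (simp add: sin_cos_eq field_simps)
      also have "\<dots> \<le> cos (pi * (real n / 2 - 1/2) / real m)"
        using b nm m \<psi> by (intro cos_pi_div_ge) auto
      also have "\<dots> \<le> cosine n m 0 b" using cosine_inner[OF nm, of b 0] b by simp
      finally show ?thesis .
    qed
    then have "\<bar>?s / cosine n m 0 b\<bar> \<le> 1"
      using cosine_0_pos[OF nm, of b] b by (simp add: field_simps)
    then show "0 \<le> 1 - (?s / cosine n m 0 b)\<^sup>2" by (simp add: abs_square_le_1)
  qed
  also have "\<dots> = exp (- (4 * curvature n m * ?s\<^sup>2))"
    by (simp add: curvature_def sum_distrib_left sum_negf power_divide power_mult_distrib
        sum_distrib_right flip: exp_sum)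
  also have "\<dots> \<le> exp (- (4 * curvature n m * (4 * \<psi>\<^sup>2 / real m ^ 2)))"
    using mult_left_mono[OF s, of "4 * curvature n m"] by (simp add: curvature_nonneg)
  also have "\<dots> = (exp (- (8 * curvature n m / real m ^ 2) * \<psi>\<^sup>2))\<^sup>2"
    by (simp flip: exp_double)
  finally show ?thesis by (rule power2_le_imp_le) simp
qed

section \<open>Pointwise limits of powers of the rescaled eigenvalue ratio\<close>

lemma tendsto_power_self_0:
  fixes X :: "nat \<Rightarrow> real"
  assumes "X \<longlonglongrightarrow> r" "\<bar>r\<bar> < 1"
  shows "(\<lambda>k. X k ^ k) \<longlonglongrightarrow> 0"
proof -
  define q where "q = (\<bar>r\<bar> + 1) / 2"
  have q: "\<bar>r\<bar> < q" "0 \<le> q" "q < 1" using assms(2) by (auto simp: q_def)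
  have "(\<lambda>k. \<bar>X k\<bar>) \<longlonglongrightarrow> \<bar>r\<bar>" using assms(1) by (intro tendsto_intros)
  from order_tendstoD(2)[OF this q(1)]
  have "eventually (\<lambda>k. norm (X k ^ k) \<le> q ^ k) sequentially"
    by eventually_elim (auto simp: power_abs intro: power_mono)
  then show ?thesis
    by (rule Lim_null_comparison) (use q in \<open>intro LIMSEQ_realpow_zero\<close>)
qed

text \<open>Both sides are even in \<open>d\<close>, which reduces the limit to
  \<open>d > 0\<close>.\<close>

lemma tendsto_one_minus_sin_power:
  fixes d c :: real
  assumes c: "c > 0"
  shows "(\<lambda>k. (1 - (sin (d / sqrt (real k)) / c)\<^sup>2) ^ k) \<longlonglongrightarrow> exp (- ((d / c)\<^sup>2))"
proof -
  have pos: "(\<lambda>k. (1 - (sin (d / sqrt (real k)) / c)\<^sup>2) ^ k) \<longlonglongrightarrow> exp (- ((d * inverse c)\<^sup>2))"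
    if "d > 0" for d
    using that c by real_asymp
  consider "d > 0" | "d = 0" | "d < 0" by linarith
  then show ?thesis
  proof cases
    case 3
    then show ?thesis using pos[of "- d"] by (simp add: divide_inverse)
  qed (use pos[of d] in \<open>simp_all add: divide_inverse\<close>)
qed

text \<open>The limit is found for the square, where \<open>prod_cosine_squared\<close> supplies
  factors with known limits. Taking the root is legitimate because the ratio is nonnegative once |t
  / sqrt k| < 1/2.\<close>

lemma tendsto_prod_cosine_ratio_power:
  assumes nm: "n \<le> m" and m: "m \<ge> 1"
  shows "(\<lambda>k. ((\<Prod>b=0..<n. cosine n m (t / sqrt (real k)) b) / (\<Prod>b=0..<n. cosine n m 0 b)) ^ k)
    \<longlonglongrightarrow> exp (- (2 * pi\<^sup>2 * curvature n m / real m ^ 2) * t\<^sup>2)"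
proof -
  let ?r = "\<lambda>k. (\<Prod>b=0..<n. cosine n m (t / sqrt (real k)) b) / (\<Prod>b=0..<n. cosine n m 0 b)"
  have "(\<lambda>k. \<Prod>b=0..<n. (1 - (sin (pi * t / real m / sqrt (real k)) / cosine n m 0 b)\<^sup>2) ^ k)
      \<longlonglongrightarrow> (\<Prod>b=0..<n. exp (- ((pi * t / real m / cosine n m 0 b)\<^sup>2)))"
    using cosine_0_pos[OF nm] by (intro tendsto_prod tendsto_one_minus_sin_power) auto
  also have "(\<lambda>k. \<Prod>b=0..<n. (1 - (sin (pi * t / real m / sqrt (real k)) / cosine n m 0 b)\<^sup>2) ^ k) =
      (\<lambda>k. (?r k ^ k)\<^sup>2)"
  proof
    fix k
    have "(?r k ^ k)\<^sup>2 = ((?r k)\<^sup>2) ^ k"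
      unfolding power_mult[symmetric] by (simp only: mult.commute)
    then show "(\<Prod>b=0..<n. (1 - (sin (pi * t / real m / sqrt (real k)) / cosine n m 0 b)\<^sup>2) ^ k) = (?r k ^ k)\<^sup>2"
      unfolding prod_cosine_squared[OF nm] by (simp add: prod_power_distrib mult_ac)
  qed
  also have "(\<Prod>b=0..<n. exp (- ((pi * t / real m / cosine n m 0 b)\<^sup>2))) =
      (exp (- (2 * pi\<^sup>2 * curvature n m / real m ^ 2) * t\<^sup>2))\<^sup>2"
    by (simp add: curvature_def sum_distrib_left sum_negf power_divide power_mult_distrib
        sum_distrib_right sum_divide_distrib mult_ac flip: exp_sum exp_double)
  finally have "(\<lambda>k. sqrt ((?r k ^ k)\<^sup>2)) \<longlonglongrightarrow> sqrt ((exp (- (2 * pi\<^sup>2 * curvature n m / real m ^ 2) * t\<^sup>2))\<^sup>2)"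
    by (rule tendsto_real_sqrt)
  moreover have "eventually (\<lambda>k. sqrt ((?r k ^ k)\<^sup>2) = ?r k ^ k) sequentially"
  proof -
    have "(\<lambda>k. t / sqrt (real k)) \<longlonglongrightarrow> 0" by real_asymp
    then have "(\<lambda>k. \<bar>t / sqrt (real k)\<bar>) \<longlonglongrightarrow> 0" by (rule tendsto_rabs_zero)
    then have "eventually (\<lambda>k. \<bar>t / sqrt (real k)\<bar> < 1/2) sequentially"
      by (rule order_tendstoD) simp
    then show ?thesis
    proof eventually_elim
      case (elim k)
      have "0 \<le> ?r k" using cosine_nonneg[OF nm] cosine_0_pos[OF nm] elim
        by (intro divide_nonneg_pos prod_nonneg prod_pos) auto
      then show ?case by simp
    qed
  qed
  ultimately show ?thesis
    by (subst (asm) tendsto_cong) auto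
qed

section \<open>Laplace's method\<close>

definition amplitude :: "nat \<Rightarrow> nat \<Rightarrow> (nat \<Rightarrow> real) \<Rightarrow> (nat \<Rightarrow> real) \<Rightarrow> (nat \<Rightarrow> nat) \<Rightarrow> real \<Rightarrow> complex" where
  "amplitude n m \<eta> x a \<psi> = (\<Prod>j=0..<n. cis (theta n m \<psi> (a j) * \<eta> (Suc j))) * slater n m \<psi> a x"

lemma spectral_integrand_eq:
  "spectral_integrand n m \<eta> k x \<psi> = (\<Sum>a\<in>PiE {0..<n} (\<lambda>_. {0..<m}).
     of_real ((2 ^ n * (\<Prod>j=0..<n. cosine n m \<psi> (a j))) ^ k) * amplitude n m \<eta> x a \<psi>)"
  by (simp add: spectral_integrand_def amplitude_def cosine_def prod.distrib mult.assoc)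

lemma continuous_on_cosine [continuous_intros]: "continuous_on A (\<lambda>\<psi>. cosine n m \<psi> b)"
  unfolding cosine_def by (intro continuous_intros) auto

lemma norm_amplitude_le: "norm (amplitude n m \<eta> x a \<psi>) \<le> fact n"
proof -
  have "norm (slater n m \<psi> a x) \<le> (\<Sum>p | p permutes {0..<n}.
     norm (of_int (sign p) * (\<Prod>l=0..<n. cis (- (theta n m \<psi> (a (p l)) * x (Suc l)))) :: complex))"
    unfolding slater_eq_sum by (rule norm_sum)
  also have "\<dots> = fact n"
  proof -
    have "norm (of_int (sign p) * (\<Prod>l=0..<n. cis (- (theta n m \<psi> (a (p l)) * x (Suc l)))) :: complex) = 1" for p
      by (simp add: norm_mult prod_norm[symmetric]) (simp add: sign_def)
    then show ?thesis by (simp add: card_permutations[OF refl])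
  qed
  finally show ?thesis
    by (simp add: amplitude_def norm_mult prod_norm[symmetric])
qed

lemma isCont_amplitude: "isCont (amplitude n m \<eta> x a) \<psi>"
proof -
  have "continuous_on UNIV (amplitude n m \<eta> x a)"
    unfolding amplitude_def by (intro continuous_intros)
  then show ?thesis by (simp add: continuous_on_eq_continuous_at)
qed

definition leading_coeff :: "nat \<Rightarrow> nat \<Rightarrow> (nat \<Rightarrow> real) \<Rightarrow> (nat \<Rightarrow> real) \<Rightarrow> complex" where
  "leading_coeff n m \<eta> x = (\<Sum>a\<in>{a \<in> PiE {0..<n} (\<lambda>_. {0..<m}). a ` {0..<n} = {0..<n}}. amplitude n m \<eta> x a 0)"

text \<open>A non-injective \<open>a\<close> has a vanishing determinant, and a permutation of the
  central block gives the Gaussian. In all other cases the ratio tends to its value at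
  \<open>\<psi> = 0\<close>, of modulus below 1, so its k-th power tends to 0.\<close>

lemma tendsto_scaled_summand:
  assumes nm: "n \<le> m" and m: "m \<ge> 1" and a: "a \<in> PiE {0..<n} (\<lambda>_. {0..<m})"
  shows "(\<lambda>k. of_real (((\<Prod>j=0..<n. cosine n m (t / sqrt (real k)) (a j)) / (\<Prod>b=0..<n. cosine n m 0 b)) ^ k) *
       amplitude n m \<eta> x a (t / sqrt (real k))) \<longlonglongrightarrow>
    (if a ` {0..<n} = {0..<n} then
       of_real (exp (- (2 * pi\<^sup>2 * curvature n m / real m ^ 2) * t\<^sup>2)) * amplitude n m \<eta> x a 0 else 0)"
proof -
  have t0: "(\<lambda>k. t / sqrt (real k)) \<longlonglongrightarrow> 0" by real_asymp
  have amp: "(\<lambda>k. amplitude n m \<eta> x a (t / sqrt (real k))) \<longlonglongrightarrow> amplitude n m \<eta> x a 0"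
    by (rule isCont_tendsto_compose[OF isCont_amplitude t0])
  have img: "a ` {0..<n} \<subseteq> {0..<m}" using a by auto
  show ?thesis
  proof (cases "inj_on a {0..<n}")
    case False
    then have "a ` {0..<n} \<noteq> {0..<n}" using eq_card_imp_inj_on[of "{0..<n}" a] by auto
    then show ?thesis using False by (simp add: amplitude_def slater_eq_0_columns)
  next
    case inj: True
    show ?thesis
    proof (cases "a ` {0..<n} = {0..<n}")
      case True
      have eq: "(\<Prod>j=0..<n. cosine n m \<psi> (a j)) = (\<Prod>b=0..<n. cosine n m \<psi> b)" for \<psi>
        using prod.reindex[OF inj, of "cosine n m \<psi>"] True by simp
      show ?thesis unfolding eq using True
        by (simp only: if_True simp_thms)
           (intro tendsto_mult tendsto_of_real tendsto_prod_cosine_ratio_power amp nm m)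
    next
      case False
      have "(\<lambda>k. (\<Prod>j=0..<n. cosine n m (t / sqrt (real k)) (a j)) / (\<Prod>b=0..<n. cosine n m 0 b)) \<longlonglongrightarrow>
          (\<Prod>j=0..<n. cosine n m 0 (a j)) / (\<Prod>b=0..<n. cosine n m 0 b)"
      proof (intro tendsto_divide tendsto_prod tendsto_const)
        fix j
        have "isCont (\<lambda>\<psi>. cosine n m \<psi> (a j)) 0"
          unfolding cosine_eq divide_inverse by (intro continuous_intros)
        then show "(\<lambda>k. cosine n m (t / sqrt (real k)) (a j)) \<longlonglongrightarrow> cosine n m 0 (a j)"
          by (rule isCont_tendsto_compose[OF _ t0])
      qed (use cosine_0_pos[OF nm] in force)
      then have "(\<lambda>k. ((\<Prod>j=0..<n. cosine n m (t / sqrt (real k)) (a j)) / (\<Prod>b=0..<n. cosine n m 0 b)) ^ k) \<longlonglongrightarrow> 0"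
        using abs_prod_cosine_0_less[OF nm img inj False] prod_cosine_0_pos[OF nm]
        by (intro tendsto_power_self_0) (auto simp: abs_divide)
      then have "(\<lambda>k. complex_of_real (((\<Prod>j=0..<n. cosine n m (t / sqrt (real k)) (a j)) / (\<Prod>b=0..<n. cosine n m 0 b)) ^ k)) \<longlonglongrightarrow> of_real 0"
        by (rule tendsto_of_real)
      from tendsto_mult[OF this amp] False show ?thesis by simp
    qed
  qed
qed

lemma gaussian_integral:
  assumes "c > 0"
  shows "integrable lborel (\<lambda>t::real. exp (- c * t\<^sup>2))"
    and "(\<integral>t. exp (- c * t\<^sup>2) \<partial>lborel) = sqrt (pi / c)"
proof -
  define \<sigma> where "\<sigma> = sqrt (1 / (2 * c))"
  have \<sigma>: "\<sigma> > 0" "2 * \<sigma>\<^sup>2 = 1 / c" using assms by (simp_all add: \<sigma>_def)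
  have eq: "exp (- c * t\<^sup>2) = sqrt (pi / c) * normal_density 0 \<sigma> t" for t
  proof -
    have "2 * pi * \<sigma>\<^sup>2 = pi / c" using \<sigma>(2) by (simp add: algebra_simps)
    then show ?thesis using \<sigma> assms by (simp add: normal_density_def mult.commute)
  qed
  show "integrable lborel (\<lambda>t::real. exp (- c * t\<^sup>2))"
    unfolding eq using \<sigma> by simp
  show "(\<integral>t. exp (- c * t\<^sup>2) \<partial>lborel) = sqrt (pi / c)"
    unfolding eq using \<sigma> by simp
qed

lemma tendsto_scaled_spectral_integral:
  assumes n: "n \<ge> 1" and nm: "n \<le> m"
  shows "(\<lambda>k. of_real (sqrt (real k) / (2 ^ n * (\<Prod>b=0..<n. cosine n m 0 b)) ^ k) *
      (\<integral>\<psi>. indicator {-(1/2)..1/2} \<psi> *\<^sub>R spectral_integrand n m \<eta> k x \<psi> \<partial>lborel)) \<longlonglongrightarrow>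
    of_real (real m / sqrt (2 * pi * curvature n m)) * leading_coeff n m \<eta> x"
proof -
  let ?I = "{-(1/2)..1/2::real}" and ?A = "PiE {0..<n} (\<lambda>_. {0..<m})"
  let ?P = "\<lambda>a \<psi>. \<Prod>j=0..<n. cosine n m \<psi> (a j)" and ?Z = "\<Prod>b=0..<n. cosine n m 0 b"
  let ?c = "2 * pi\<^sup>2 * curvature n m / real m ^ 2"
  let ?d = "8 * curvature n m / real m ^ 2"
  have m: "m \<ge> 1" using n nm by simp
  have P0: "?Z > 0" by (rule prod_cosine_0_pos[OF nm])
  have curv: "curvature n m > 0" using curvature_pos n nm by simp
  define h where "h k \<psi> = (\<Sum>a\<in>?A. of_real ((?P a \<psi> / ?Z) ^ k) * amplitude n m \<eta> x a \<psi>)" for k \<psi>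
  define s where "s k t = indicator ?I (t / sqrt (real k)) *\<^sub>R h k (t / sqrt (real k))" for k t
  define f where "f t = of_real (exp (- ?c * t\<^sup>2)) * leading_coeff n m \<eta> x" for t
  \<comment> \<open>There are \<open>card ?A\<close> summands, each at most a Gaussian times n!, the
    number of unimodular terms in the determinant.\<close>
  define w where "w t = real (card ?A) * fact n * exp (- ?d * t\<^sup>2)" for t
  have integrand: "of_real (1 / (2 ^ n * ?Z) ^ k) * spectral_integrand n m \<eta> k x \<psi> = h k \<psi>" for k \<psi>
    using P0 unfolding spectral_integrand_eq h_def sum_distrib_left
    by (intro sum.cong refl) (simp add: power_mult_distrib power_divide)
  have h_cont: "continuous_on UNIV (h k)" for k
    unfolding h_def amplitude_def using P0
    by (intro continuous_intros) (use cosine_0_pos[OF nm] in force)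
  have [measurable]: "h k \<in> borel_measurable borel" for k
    using h_cont by (rule borel_measurable_continuous_onI)
  have [measurable]: "s k \<in> borel_measurable lborel" for k
    unfolding s_def by measurable
  have [measurable]: "f \<in> borel_measurable lborel" unfolding f_def by measurable
  have lim: "(\<lambda>k. s k t) \<longlonglongrightarrow> f t" for t
  proof -
    have "(\<lambda>k. t / sqrt (real k)) \<longlonglongrightarrow> 0" by real_asymp
    then have "(\<lambda>k. \<bar>t / sqrt (real k)\<bar>) \<longlonglongrightarrow> 0" by (rule tendsto_rabs_zero)
    then have "eventually (\<lambda>k. \<bar>t / sqrt (real k)\<bar> < 1/2) sequentially"
      by (rule order_tendstoD) simp
    then have ev: "eventually (\<lambda>k. h k (t / sqrt (real k)) = s k t) sequentially"
    proof eventually_elim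
      case (elim k)
      then have "t / sqrt (real k) \<in> ?I" unfolding atLeastAtMost_iff by linarith
      then have "indicator ?I (t / sqrt (real k)) = (1 :: real)" by (rule indicator_simps(1))
      then show ?case by (simp only: s_def scaleR_one)
    qed
    have "(\<lambda>k. h k (t / sqrt (real k))) \<longlonglongrightarrow> (\<Sum>a\<in>?A. if a ` {0..<n} = {0..<n} then
       of_real (exp (- ?c * t\<^sup>2)) * amplitude n m \<eta> x a 0 else 0)"
      unfolding h_def by (intro tendsto_sum tendsto_scaled_summand nm m)
    also have "(\<Sum>a\<in>?A. if a ` {0..<n} = {0..<n} then
       of_real (exp (- ?c * t\<^sup>2)) * amplitude n m \<eta> x a 0 else 0) = f t"
      unfolding f_def leading_coeff_def sum_distrib_left
      by (rule sum.inter_filter[symmetric]) (simp add: finite_PiE)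
    finally show ?thesis using ev by (rule Lim_transform_eventually)
  qed
  have bound: "norm (s k t) \<le> w t" if k: "k > 0" for k t
  proof (cases "t / sqrt (real k) \<in> ?I")
    case False
    then show ?thesis by (simp add: s_def w_def)
  next
    case True
    define \<psi> where "\<psi> = t / sqrt (real k)"
    have \<psi>: "\<bar>\<psi>\<bar> \<le> 1/2" using True by (auto simp: \<psi>_def)
    have term_le: "norm (of_real ((?P a \<psi> / ?Z) ^ k) * amplitude n m \<eta> x a \<psi>) \<le> exp (- ?d * \<psi>\<^sup>2) ^ k * fact n"
      if a: "a \<in> ?A" for a
    proof (cases "inj_on a {0..<n}")
      case False
      then show ?thesis by (simp add: amplitude_def slater_eq_0_columns)
    next
      case inj: True
      have "\<bar>?P a \<psi> / ?Z\<bar> \<le> (\<Prod>b=0..<n. cosine n m \<psi> b) / ?Z"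
        using abs_prod_cosine_le[OF nm _ inj \<psi>] a P0 by (auto simp: abs_divide intro!: divide_right_mono)
      also have "\<dots> \<le> exp (- ?d * \<psi>\<^sup>2)" by (rule prod_cosine_ratio_le[OF nm m \<psi>])
      finally have "\<bar>?P a \<psi> / ?Z\<bar> ^ k \<le> exp (- ?d * \<psi>\<^sup>2) ^ k" by (intro power_mono) auto
      then show ?thesis
        unfolding norm_mult norm_of_real power_abs
        by (intro mult_mono norm_amplitude_le) auto
    qed
    have "norm (s k t) = norm (h k \<psi>)" using True by (simp add: s_def \<psi>_def)
    also have "\<dots> \<le> (\<Sum>a\<in>?A. exp (- ?d * \<psi>\<^sup>2) ^ k * fact n)"
      unfolding h_def by (intro sum_norm_le term_le)
    also have "\<dots> = real (card ?A) * fact n * exp (- ?d * (real k * \<psi>\<^sup>2))"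
      by (simp add: exp_of_nat_mult[symmetric] mult_ac)
    also have "real k * \<psi>\<^sup>2 = t\<^sup>2"
      using k by (simp add: \<psi>_def power_divide)
    finally show ?thesis by (simp add: w_def)
  qed
  have "(\<lambda>k. \<integral>t. s (Suc k) t \<partial>lborel) \<longlonglongrightarrow> (\<integral>t. f t \<partial>lborel)"
  proof (rule integral_dominated_convergence[where w = w])
    show "integrable lborel w"
      unfolding w_def using gaussian_integral(1)[of ?d] curv m by (intro integrable_mult_right) auto
  qed (use LIMSEQ_Suc[OF lim] bound in auto)
  then have lim_s: "(\<lambda>k. \<integral>t. s k t \<partial>lborel) \<longlonglongrightarrow> (\<integral>t. f t \<partial>lborel)"
    by (rule LIMSEQ_imp_Suc)
  have int_f: "(\<integral>t. f t \<partial>lborel) = of_real (real m / sqrt (2 * pi * curvature n m)) * leading_coeff n m \<eta> x"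
  proof -
    have "pi / ?c = real m ^ 2 / (2 * pi * curvature n m)"
      using curv m by (simp add: field_simps power2_eq_square)
    then have "sqrt (pi / ?c) = real m / sqrt (2 * pi * curvature n m)"
      by (simp add: real_sqrt_divide)
    then show ?thesis
      unfolding f_def using gaussian_integral(2)[of ?c] curv m by simp
  qed
  have "eventually (\<lambda>k. (\<integral>t. s k t \<partial>lborel) =
      of_real (sqrt (real k) / (2 ^ n * ?Z) ^ k) *
      (\<integral>\<psi>. indicator ?I \<psi> *\<^sub>R spectral_integrand n m \<eta> k x \<psi> \<partial>lborel)) sequentially"
    using eventually_gt_at_top[of 0]
  proof eventually_elim
    case (elim k)
    have "of_real (1 / (2 ^ n * ?Z) ^ k) * (\<integral>\<psi>. indicator ?I \<psi> *\<^sub>R spectral_integrand n m \<eta> k x \<psi> \<partial>lborel) =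
        (\<integral>\<psi>. indicator ?I \<psi> *\<^sub>R h k \<psi> \<partial>lborel)"
      unfolding integrand[symmetric] by (simp flip: integral_mult_right_zero)
    also have "\<dots> = (1 / sqrt (real k)) *\<^sub>R (\<integral>t. s k t \<partial>lborel)"
      using elim by (subst lborel_integral_real_affine[where c = "1 / sqrt (real k)" and t = 0]) (simp_all add: s_def[abs_def])
    finally show ?case using elim
      by (simp add: scaleR_conv_of_real field_simps)
  qed
  from Lim_transform_eventually[OF lim_s[unfolded int_f] this] show ?thesis .
qed

section \<open>The leading coefficient\<close>

lemma slater_permutation:
  assumes p: "p permutes {0..<n}"
  shows "slater n m \<psi> p x = of_int (sign p) * slater n m \<psi> id x"
proof -
  let ?f = "\<lambda>q. of_int (sign q) * (\<Prod>l=0..<n. cis (- (theta n m \<psi> (q l) * x (Suc l))))"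
  have "of_int (sign p) * slater n m \<psi> id x = (\<Sum>q | q permutes {0..<n}. of_int (sign p) * ?f (p \<circ> q))"
    unfolding slater_eq_sum sum_distrib_left
    by (rule sum.reindex_bij_witness[of _ "\<lambda>q. p \<circ> q" "\<lambda>q. Hilbert_Choice.inv p \<circ> q"])
       (use p in \<open>auto simp: permutes_compose permutes_inv o_assoc permutes_inv_o\<close>)
  also have "\<dots> = slater n m \<psi> p x"
    unfolding slater_eq_sum
  proof (intro sum.cong refl)
    fix q assume "q \<in> {q. q permutes {0..<n}}"
    then have "sign (p \<circ> q) = sign p * sign q"
      using p by (intro sign_compose) (auto intro: permutes_imp_permutation[of "{0..<n}"])
    then show "of_int (sign p) * ?f (p \<circ> q) =
        of_int (sign q) * (\<Prod>l=0..<n. cis (- (theta n m \<psi> (p (q l)) * x (Suc l))))"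
      by (simp add: mult.assoc[symmetric] flip: of_int_mult)
  qed
  finally show ?thesis ..
qed

lemma slater_id_0:
  "slater n m 0 id x = (\<Prod>t<n. \<Prod>h<t. 2 * \<i> * complex_of_real (sin (pi * (x (Suc h) - x (Suc t)) / real m)))"
proof -
  have eq: "slater n m 0 id x = (\<Prod>t<n. \<Prod>h<t.
      2 * \<i> * complex_of_real (sin ((- (2 * pi * x (Suc t) / real m) - - (2 * pi * x (Suc h) / real m)) / 2)))"
  proof -
    have "- (theta n m 0 (id j) * x (Suc l)) = (real j - (real n - 1) / 2) * (- (2 * pi * x (Suc l) / real m))" for j l
      by (simp add: theta_def)
    then show ?thesis unfolding slater_def det_cis_centred[symmetric] by (simp only:)
  qed
  have "(- (2 * pi * x (Suc t) / real m) - - (2 * pi * x (Suc h) / real m)) / 2 =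
      pi * (x (Suc h) - x (Suc t)) / real m" for t h
    by (simp add: diff_divide_distrib right_diff_distrib)
  then show ?thesis unfolding eq by (simp only:)
qed

text \<open>Reordering the momenta only changes the sign of the determinant in \<open>x\<close>,
  which therefore factors out; the signed sum of plane waves in \<open>\<eta>\<close> that remains
  is a conjugated determinant.\<close>

lemma leading_coeff_eq:
  assumes nm: "n \<le> m"
  shows "leading_coeff n m \<eta> x = cnj (slater n m 0 id \<eta>) * slater n m 0 id x"
proof -
  let ?\<theta> = "theta n m 0"
  have "leading_coeff n m \<eta> x = (\<Sum>p | p permutes {0..<n}. amplitude n m \<eta> x p 0)"
    unfolding leading_coeff_def
  \<comment> \<open>Members of \<open>PiE\<close> are \<open>undefined\<close> off {0..<n},
    permutations are the identity there; the two maps translate between these conventions.\<close>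
  proof (rule sum.reindex_bij_witness[of _ "\<lambda>p. restrict p {0..<n}" "\<lambda>a j. if j \<in> {0..<n} then a j else j"])
    fix a assume a: "a \<in> {a \<in> PiE {0..<n} (\<lambda>_. {0..<m}). a ` {0..<n} = {0..<n}}"
    show "restrict (\<lambda>j. if j \<in> {0..<n} then a j else j) {0..<n} = a"
      using a by (auto simp: fun_eq_iff PiE_def extensional_def)
    have "inj_on a {0..<n}" using a by (intro eq_card_imp_inj_on) auto
    with a have "bij_betw a {0..<n} {0..<n}" by (auto simp: bij_betw_def)
    then have "bij_betw (\<lambda>j. if j \<in> {0..<n} then a j else j) {0..<n} {0..<n}"
      by (subst bij_betw_cong[where g = a]) auto
    then show "(\<lambda>j. if j \<in> {0..<n} then a j else j) \<in> {p. p permutes {0..<n}}"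
      by (auto intro!: bij_imp_permutes)
    show "amplitude n m \<eta> x (\<lambda>j. if j \<in> {0..<n} then a j else j) 0 = amplitude n m \<eta> x a 0"
      unfolding amplitude_def slater_def
      by (intro arg_cong2[of _ _ _ _ "(*)"] prod.cong arg_cong[where f = Determinant.det] eq_matI) auto
  next
    fix p assume "p \<in> {p. p permutes {0..<n}}"
    then have p: "p permutes {0..<n}" by simp
    have "p ` {0..<n} = {0..<n}" by (rule permutes_image[OF p])
    moreover have "p j < m" if "j < n" for j
      using permutes_in_image[OF p, of j] that nm by auto
    ultimately show "restrict p {0..<n} \<in> {a \<in> PiE {0..<n} (\<lambda>_. {0..<m}). a ` {0..<n} = {0..<n}}"
      by auto
    show "(\<lambda>j. if j \<in> {0..<n} then restrict p {0..<n} j else j) = p"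
      using p by (auto simp: fun_eq_iff permutes_def)
  qed
  also have "\<dots> = (\<Sum>p | p permutes {0..<n}. of_int (sign p) * (\<Prod>j=0..<n. cis (?\<theta> (p j) * \<eta> (Suc j)))) * slater n m 0 id x"
    unfolding sum_distrib_right
  proof (intro sum.cong refl)
    fix p assume "p \<in> {p. p permutes {0..<n}}"
    then have p: "p permutes {0..<n}" by simp
    show "amplitude n m \<eta> x p 0 = of_int (sign p) * (\<Prod>j=0..<n. cis (?\<theta> (p j) * \<eta> (Suc j))) * slater n m 0 id x"
      unfolding amplitude_def slater_permutation[OF p] by (simp only: mult_ac)
  qed
  also have "(\<Sum>p | p permutes {0..<n}. of_int (sign p) * (\<Prod>j=0..<n. cis (?\<theta> (p j) * \<eta> (Suc j)))) =
      cnj (slater n m 0 id \<eta>)"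
    unfolding slater_eq_sum by (simp add: cis_cnj)
  finally show ?thesis .
qed

lemma prod_pairs_eq:
  fixes f :: "nat \<Rightarrow> nat \<Rightarrow> 'a :: comm_monoid_mult"
  shows "(\<Prod>(h, t)\<in>{(h, t). 1 \<le> h \<and> h < t \<and> t \<le> n}. f h t) = (\<Prod>t<n. \<Prod>h<t. f (Suc h) (Suc t))"
proof -
  have "(\<Prod>t<n. \<Prod>h<t. f (Suc h) (Suc t)) = (\<Prod>(t, h)\<in>(SIGMA t:{..<n}. {..<t}). f (Suc h) (Suc t))"
    by (rule prod.Sigma) auto
  also have "\<dots> = (\<Prod>(h, t)\<in>{(h, t). 1 \<le> h \<and> h < t \<and> t \<le> n}. f h t)"
    by (rule prod.reindex_bij_witness[of _ "\<lambda>(h, t). (t - 1, h - 1)" "\<lambda>(t, h). (Suc h, Suc t)"]) auto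
  finally show ?thesis ..
qed

text \<open>Each of the n(n-1)/2 pairs contributes 2i from one determinant and its conjugate from
  the other: the source of the power of 2 in the theorem.\<close>

lemma prod_triangle_const4: "(\<Prod>t<n. \<Prod>h<t. 4) = (2 :: real) ^ (n\<^sup>2 - n)"
proof (induction n)
  case (Suc n)
  have "(Suc n)\<^sup>2 - Suc n = (n\<^sup>2 - n) + 2 * n"
    by (cases n) (auto simp: power2_eq_square)
  then show ?case using Suc by (simp add: power_add power_mult)
qed simp

lemma leading_coeff_eq_prod_sin:
  assumes nm: "n \<le> m"
  shows "leading_coeff n m \<eta> x = of_real (2 ^ (n\<^sup>2 - n) * (\<Prod>(h, t)\<in>{(h, t). 1 \<le> h \<and> h < t \<and> t \<le> n}.
    sin (pi * (\<eta> h - \<eta> t) / real m) * sin (pi * (x h - x t) / real m)))"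
proof -
  have "leading_coeff n m \<eta> x = (\<Prod>t<n. \<Prod>h<t. of_real (4 *
      (sin (pi * (\<eta> (Suc h) - \<eta> (Suc t)) / real m) * sin (pi * (x (Suc h) - x (Suc t)) / real m))))"
    unfolding leading_coeff_eq[OF nm] slater_id_0 cnj_prod prod.distrib[symmetric]
    by (intro prod.cong refl) (simp add: mult_ac)
  then show ?thesis
    unfolding prod_pairs_eq prod_triangle_const4[symmetric] prod.distrib[symmetric] of_real_prod by simp
qed

text \<open>Integer gaps are at least 1, so n coordinates span at least n - 1, which must stay below
  m. The positivity of the central cosines rests on this bound.\<close>

lemma alcove_nonempty_imp_le:
  assumes "x \<in> alcove n (real m)" "n \<ge> 1" "\<And>j. j \<in> {1..<n} \<Longrightarrow> x j - x (j + 1) \<in> \<int>"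
  shows "n \<le> m"
proof -
  have "x (Suc i) \<le> x 1 - real i" if "i < n" for i
    using that
  proof (induction i)
    case (Suc i)
    have "x (Suc i) - x (Suc i + 1) \<in> \<int>" "x (Suc i) - x (Suc i + 1) > 0"
      using assms(1) assms(3)[of "Suc i"] Suc.prems by (auto simp: alcove_def)
    then have "x (Suc i) - x (Suc i + 1) \<ge> 1" by (auto elim!: Ints_cases)
    then show ?case using Suc by simp
  qed simp
  from this[of "n - 1"] have "x n \<le> x 1 - real (n - 1)" using assms(2) by simp
  moreover have "x n > x 1 - real m" using assms(1) by (simp add: alcove_def)
  ultimately have "real (n - 1) < real m" by linarith
  then show ?thesis by simp
qed

section \<open>Assembly of the asymptotic formula\<close>

theorem theorem16:
  fixes n m :: nat and \<eta> lam :: "nat \<Rightarrow> real" and c0 :: real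
  assumes "n \<ge> 1" and "m \<ge> 1"
    and "\<eta> \<in> alcove n (real m)" and "lam \<in> alcove n (real m)"
    and "(\<forall>j\<in>{1..n}. \<eta> j \<in> \<int> \<and> lam j \<in> \<int>) \<or>
         (\<forall>j\<in>{1..n}. \<eta> j \<in> half_integers \<and> lam j \<in> half_integers)"
  defines "c0 \<equiv> (\<Sum>j=1..n. 1 / (2 * cos (pi * (real j - (real n + 1) / 2) / real m)) ^ 2)"
  shows "((\<lambda>k. real (card (walks (diagonal_steps n) (alcove n (real m)) \<eta> lam k)) /
            (1 / real m ^ (n - 1) * (2 ^ (n^2 - n) / sqrt (2 * pi * c0 * real k)) *
             (2 ^ n * (\<Prod>j=1..n. cos (pi * (real j - (real n + 1) / 2) / real m))) ^ k *
             (\<Prod>(h, t)\<in>{(h, t). 1 \<le> h \<and> h < t \<and> t \<le> n}.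
                sin (pi * (\<eta> h - \<eta> t) / real m) * sin (pi * (lam h - lam t) / real m))))
          \<longlongrightarrow> 1)
         (inf sequentially (principal {k. \<forall>j\<in>{1..n}. [real k = 2 * \<eta> j + 2 * lam j] (rmod 2)}))"
proof -
  let ?K = "{k::nat. \<forall>j\<in>{1..n}. [real k = 2 * \<eta> j + 2 * lam j] (rmod 2)}"
  define S where "S = (\<Prod>(h, t)\<in>{(h, t). 1 \<le> h \<and> h < t \<and> t \<le> n}.
     sin (pi * (\<eta> h - \<eta> t) / real m) * sin (pi * (lam h - lam t) / real m))"
  define P where "P = (\<Prod>b=0..<n. cosine n m 0 b)"
  define T where "T k = (\<integral>\<psi>. indicator {-(1/2)..1/2} \<psi> *\<^sub>R spectral_integrand n m \<eta> k lam \<psi> \<partial>lborel)" for k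
  have diff_Int: "x - y \<in> \<int> \<and> x + y \<in> \<int>"
    if "x \<in> \<int> \<and> y \<in> \<int> \<or> x \<in> half_integers \<and> y \<in> half_integers" for x y :: real
    using that
  proof
    assume "x \<in> half_integers \<and> y \<in> half_integers"
    then obtain a b :: int where ab: "odd a" "odd b" "x = of_int a / 2" "y = of_int b / 2"
      by (auto simp: half_integers_def)
    then obtain c d where "a - b = 2 * c" "a + b = 2 * d"
      by (metis dvdE even_add odd_even_add even_diff)
    then have "real_of_int a - real_of_int b = 2 * of_int c" "real_of_int a + real_of_int b = 2 * of_int d"
      by (metis of_int_diff of_int_mult of_int_numeral, metis of_int_add of_int_mult of_int_numeral)
    then have "x - y = of_int c" "x + y = of_int d" using ab by (simp_all add: field_simps)
    then show ?thesis by simp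
  qed auto
  have Int: "x l - y l' \<in> \<int> \<and> x l + y l' \<in> \<int>"
    if "l \<in> {1..n}" "l' \<in> {1..n}" "x \<in> {\<eta>, lam}" "y \<in> {\<eta>, lam}" for x y l l'
    using assms(5) that by (intro diff_Int) blast
  have nm: "n \<le> m"
    using Int by (intro alcove_nonempty_imp_le[OF assms(3,1)]) auto
  have c0: "c0 = curvature n m"
    unfolding c0_def curvature_def cosine_eq
    by (rule sum.reindex_bij_witness[of _ Suc "\<lambda>j. j - 1"]) (auto simp: of_nat_diff field_simps)
  have P_eq: "(\<Prod>j=1..n. cos (pi * (real j - (real n + 1) / 2) / real m)) = P"
    unfolding P_def cosine_eq
    by (rule prod.reindex_bij_witness[of _ Suc "\<lambda>j. j - 1"]) (auto simp: of_nat_diff field_simps)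
  have P: "P > 0" unfolding P_def by (rule prod_cosine_0_pos[OF nm])
  have curv: "curvature n m > 0" using curvature_pos nm assms(1) by simp
  \<comment> \<open>All these coordinate differences lie strictly between 0 and m, so the product of
    sines in the denominator is nonzero.\<close>
  have sin_pos: "sin (pi * (x h - x t) / real m) > 0"
    if "x \<in> alcove n (real m)" "1 \<le> h" "h < t" "t \<le> n" for x h t
  proof (rule sin_gt_zero)
    show "0 < pi * (x h - x t) / real m"
      using alcove_less[OF that] assms(2) by simp
    have "pi * (x h - x t) < pi * real m"
      using alcove_diff_less[OF that(1), of h t] that by simp
    then show "pi * (x h - x t) / real m < pi"
      using assms(2) by (simp add: field_simps)
  qed
  have S: "S > 0"
    unfolding S_def using sin_pos assms(3,4) by (intro prod_pos) auto
  let ?X = "\<lambda>k. of_real (sqrt (real k) / (2 ^ n * P) ^ k) * T k"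
  let ?E = "\<lambda>k. 1 / real m ^ (n - 1) * (2 ^ (n^2 - n) / sqrt (2 * pi * c0 * real k)) * (2 ^ n * P) ^ k * S"
  \<comment> \<open>The reciprocal of the limit of \<open>?X\<close>.\<close>
  let ?C = "sqrt (2 * pi * curvature n m) / (real m * 2 ^ (n\<^sup>2 - n) * S)"
  have "?X \<longlonglongrightarrow> of_real (real m / sqrt (2 * pi * curvature n m)) * leading_coeff n m \<eta> lam"
    unfolding T_def P_def by (rule tendsto_scaled_spectral_integral[OF assms(1) nm])
  then have "(\<lambda>k. of_real ?C * ?X k) \<longlonglongrightarrow> of_real ?C * (of_real (real m / sqrt (2 * pi * curvature n m)) * leading_coeff n m \<eta> lam)"
    by (rule tendsto_mult_left)
  also have "of_real ?C * (of_real (real m / sqrt (2 * pi * curvature n m)) * leading_coeff n m \<eta> lam) = 1"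
  proof -
    have "?C * (real m / sqrt (2 * pi * curvature n m) * (2 ^ (n\<^sup>2 - n) * S)) = 1"
      using curv S assms(2) by (simp add: field_simps)
    then show ?thesis
      unfolding leading_coeff_eq_prod_sin[OF nm] S_def[symmetric] by (metis of_real_1 of_real_mult)
  qed
  finally have "((\<lambda>k. of_real ?C * ?X k) \<longlongrightarrow> 1) (inf sequentially (principal ?K))"
    by (rule tendsto_mono[OF inf_le1])
  moreover have "eventually (\<lambda>k. of_real ?C * ?X k =
      of_real (real (card (walks (diagonal_steps n) (alcove n (real m)) \<eta> lam k)) / ?E k))
      (inf sequentially (principal ?K))"
    unfolding eventually_inf_principal
    using eventually_gt_at_top[of 0]
  proof (eventually_elim, intro impI)
    fix k :: nat assume k: "k > 0" "k \<in> ?K"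
    have "1 \<in> {1..n}" using assms(1) by simp
    with k(2) have "[real k = 2 * \<eta> 1 + 2 * lam 1] (rmod 2)" by blast
    \<comment> \<open>For integers and for half-integers alike, twice the sum of two coordinates is
      even, so the filter selects even k; these are the k for which \<open>real k / 2\<close>
      matches the integral differences between \<open>lam\<close> and \<open>\<eta>\<close>.\<close>
    then have "frac (real k / 2) = frac (\<eta> 1 + lam 1)"
      by (simp add: rcong_def rmod_conv_frac add_divide_distrib)
    also have "\<dots> = 0" using Int[of 1 1 \<eta> lam] assms(1) by simp
    finally have k_Int: "real k / 2 \<in> \<int>" by simp
    have "of_nat (card (walks (diagonal_steps n) (alcove n (real m)) \<eta> lam k)) = spectral_count n m \<eta> k lam"
    proof (rule of_nat_card_walks_eq_spectral_count[OF assms(1-4)])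
      show "\<forall>l\<in>{1..n}. lam l - \<eta> l - real k / 2 \<in> \<int>"
        using Int k_Int by (intro ballI Ints_diff[of "_ - _"]) auto
    qed (use Int in auto)
    then have card: "complex_of_real (real (card (walks (diagonal_steps n) (alcove n (real m)) \<eta> lam k))) =
        of_real (1 / real m ^ n) * T k"
      by (simp add: spectral_count_def T_def)
    \<comment> \<open>The factor m in the denominator of \<open>?C\<close> and the normalisation 1 /
      m^n combine to the exponent n - 1; splitting on n resolves the truncated subtraction.\<close>
    have "?C * (sqrt (real k) / (2 ^ n * P) ^ k) = 1 / real m ^ n / ?E k"
      using k curv S P assms(1,2) unfolding c0 real_sqrt_mult
      by (cases n) (simp_all add: field_simps)
    then have "of_real ?C * ?X k = of_real (1 / real m ^ n / ?E k) * T k"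
      by (simp only: mult.assoc[symmetric] of_real_mult[symmetric])
    also have "\<dots> = of_real (1 / real m ^ n) * T k / of_real (?E k)"
      by (subst of_real_divide) (rule times_divide_eq_left)
    finally show "of_real ?C * ?X k = of_real (real (card (walks (diagonal_steps n) (alcove n (real m)) \<eta> lam k)) / ?E k)"
      unfolding of_real_divide[of _ "?E k"] card .
  qed
  ultimately have "((\<lambda>k. complex_of_real (real (card (walks (diagonal_steps n) (alcove n (real m)) \<eta> lam k)) / ?E k))
      \<longlongrightarrow> of_real 1) (inf sequentially (principal ?K))"
    by (simp only: of_real_1) (rule Lim_transform_eventually)
  then show ?thesis
    unfolding tendsto_of_real_iff P_eq S_def[symmetric] .
qed

end
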